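(* Let $k\ge1$ and $\delta>0$, and let $\mu$ be a Borel probability measure on $\{0,1\}^{[k]^\ast}$ such that $\mu\{\mathbf x:\ x_w=1\}\ge\delta$ for every $w\in[k]^\ast$. Then there is a combinatorial line $\phi:[k]\hookrightarrow[k]^\ast$ such that \[\mu\{\mathbf x\in\{0,1\}^{[k]^\ast}:\ x_{\phi(i)}=1\ \forall i\in[k]\}>0.\]
   Context: $[k]^\ast=\bigcup_{N\ge1}[k]^N$ is the set of finite nonempty words over $[k]=\{1,\dots,k\}$. A combinatorial line in $[k]^\ast$ is an injection $\phi:[k]\hookrightarrow[k]^\ast$ specified by an integer $N_1\ge1$, a nonempty $I_1\subseteq[N_1]$ and a word $w\in[k]^{N_1}$, where $\phi(v)\in[k]^{N_1}$ is given by $\phi(v)_m=w_m$ for $m\in[N_1]\setminus I_1$ and $\phi(v)_m=v$ for $m\in I_1$. *)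

theory Defs
  imports "HOL-Probability.Probability"
begin

definition words :: "nat \<Rightarrow> nat list set" where
  "words k = {w. w \<noteq> [] \<and> set w \<subseteq> {1..k}}"

definition line_word :: "nat \<Rightarrow> nat set \<Rightarrow> nat list \<Rightarrow> nat \<Rightarrow> nat list" where
  "line_word N I w v = map (\<lambda>m. if m \<in> I then v else w ! (m - 1)) [1..<N+1]"

definition comb_line :: "nat \<Rightarrow> (nat \<Rightarrow> nat list) \<Rightarrow> bool" where
  "comb_line k \<phi> \<longleftrightarrow> (\<exists>N I w. N \<ge> 1 \<and> I \<subseteq> {1..N} \<and> I \<noteq> {} \<and>
      length w = N \<and> set w \<subseteq> {1..k} \<and> (\<forall>v\<in>{1..k}. \<phi> v = line_word N I w v))"

text \<open>Borel sigma-algebra on {0,1}^{[k]^*}: since [k]^* is countable and {0,1} discrete,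
  it coincides with the product sigma-algebra.\<close>
definition cube_measure :: "nat \<Rightarrow> (nat list \<Rightarrow> bool) measure" where
  "cube_measure k = PiM (words k) (\<lambda>_. count_space UNIV)"

end

theory Submission
  imports Defs
begin

text \<open>
  If every line had measure zero, then almost every \<open>x\<close> would give a line-free subset of \<open>[k]\<^sup>n\<close>, yet
  the average density of these subsets is at least \<open>\<delta>\<close>; so it suffices to prove the density
  Hales--Jewett theorem.  This is done by induction on the alphabet, following the density increment
  strategy of Polymath and of Dodos, Kanellopoulos and Tyros.  Let \<open>\<Delta>\<close> be the infimum of the densities
  that force a line over \<open>k + 1\<close> letters, and let \<open>D\<close> be line-free of density just below \<open>\<Delta>\<close>; then all
  sections of \<open>D\<close> over a fixed number of coordinates have density close to \<open>\<Delta>\<close>.  The theorem for \<open>k\<close>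
  letters yields a subspace on which the set \<open>S\<close> of words \<open>x\<close> such that all recolourings of \<open>x\<close> (letter
  \<open>k\<close> replaced by some \<open>b < k\<close>) lie in \<open>D\<close> has density bounded below, independently of the
  dimension of the subspace.  Being line-free, \<open>D\<close> essentially misses \<open>S\<close>, so it has density above
  \<open>\<Delta>\<close> on one of \<open>k\<close> pieces of the complement of \<open>S\<close>, each an intersection of sets insensitive to
  exchanging \<open>k\<close> with some \<open>b < k\<close>.  Again by the theorem for \<open>k\<close> letters, such pieces are almost
  partitioned into large subspaces, on one of which \<open>D\<close> has density above \<open>\<Delta>\<close>: a contradiction.
\<close>

section \<open>Averages over words\<close>

definition cube :: "nat \<Rightarrow> nat \<Rightarrow> nat list set" where
  "cube K n = {w. length w = n \<and> set w \<subseteq> {..<K}}"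

definition mean :: "nat \<Rightarrow> nat \<Rightarrow> (nat list \<Rightarrow> real) \<Rightarrow> real" where
  "mean K n f = (\<Sum>w\<in>cube K n. f w) / real K ^ n"

definition dens :: "nat \<Rightarrow> nat \<Rightarrow> (nat list \<Rightarrow> bool) \<Rightarrow> real" where
  "dens K n P = mean K n (\<lambda>w. of_bool (P w))"

lemma finite_cube [simp]: "finite (cube K n)"
proof -
  have "cube K n = {w. set w \<subseteq> {..<K} \<and> length w = n}" by (auto simp: cube_def)
  then show ?thesis using finite_lists_length_eq[of "{..<K}" n] by simp
qed

lemma card_cube: "card (cube K n) = K ^ n"
proof -
  have "cube K n = {w. set w \<subseteq> {..<K} \<and> length w = n}" by (auto simp: cube_def)
  then show ?thesis using card_lists_length_eq[of "{..<K}" n] by simp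
qed

lemma cube_length: "w \<in> cube K n \<Longrightarrow> length w = n"
  by (simp add: cube_def)

lemma cube_nth: "w \<in> cube K n \<Longrightarrow> i < n \<Longrightarrow> w ! i < K"
  by (auto simp: cube_def subset_iff)

lemma cube_0 [simp]: "cube K 0 = {[]}"
  by (auto simp: cube_def)

lemma append_cube: "x \<in> cube K m \<Longrightarrow> y \<in> cube K n \<Longrightarrow> x @ y \<in> cube K (m + n)"
  by (auto simp: cube_def)

lemma cube_Suc: "cube K (Suc n) = (\<lambda>(a, w). a # w) ` ({..<K} \<times> cube K n)"
proof (intro equalityI subsetI)
  fix x assume "x \<in> cube K (Suc n)"
  then show "x \<in> (\<lambda>(a, w). a # w) ` ({..<K} \<times> cube K n)"
    by (cases x) (auto simp: cube_def)
qed (auto simp: cube_def)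

lemma cube_mono: "K \<le> L \<Longrightarrow> cube K n \<subseteq> cube L n"
  by (auto simp: cube_def)

lemma mean_0 [simp]: "mean K 0 f = f []"
  by (simp add: mean_def)

lemma mean_Suc: "mean K (Suc n) f = (\<Sum>a<K. mean K n (\<lambda>w. f (a # w))) / real K"
proof -
  have "(\<Sum>w\<in>cube K (Suc n). f w) = (\<Sum>(a, w)\<in>{..<K} \<times> cube K n. f (a # w))"
    unfolding cube_Suc by (subst sum.reindex) (auto simp: inj_on_def case_prod_unfold)
  also have "\<dots> = (\<Sum>a<K. \<Sum>w\<in>cube K n. f (a # w))"
    by (simp add: sum.cartesian_product)
  finally show ?thesis
    by (simp add: mean_def sum_divide_distrib[symmetric] mult.commute)
qed

lemma mean_cong: "(\<And>w. w \<in> cube K n \<Longrightarrow> f w = g w) \<Longrightarrow> mean K n f = mean K n g"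
  by (simp add: mean_def)

lemma mean_mono: "(\<And>w. w \<in> cube K n \<Longrightarrow> f w \<le> g w) \<Longrightarrow> mean K n f \<le> mean K n g"
  by (simp add: mean_def divide_right_mono sum_mono)

lemma mean_add: "mean K n (\<lambda>w. f w + g w) = mean K n f + mean K n g"
  by (simp add: mean_def sum.distrib add_divide_distrib)

lemma mean_diff: "mean K n (\<lambda>w. f w - g w) = mean K n f - mean K n g"
  by (simp add: mean_def sum_subtractf diff_divide_distrib)

lemma mean_cmult: "mean K n (\<lambda>w. c * f w) = c * mean K n f"
  by (simp add: mean_def sum_distrib_left)

lemma mean_const: "K > 0 \<Longrightarrow> mean K n (\<lambda>_. c) = c"
  by (simp add: mean_def card_cube)

lemma mean_sum: "mean K n (\<lambda>w. \<Sum>i\<in>I. f i w) = (\<Sum>i\<in>I. mean K n (f i))"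
  unfolding mean_def by (subst sum.swap) (simp add: sum_divide_distrib)

lemma mean_swap: "mean K m (\<lambda>x. mean L n (\<lambda>y. f x y)) = mean L n (\<lambda>y. mean K m (\<lambda>x. f x y))"
  unfolding mean_def
  by (simp add: sum_divide_distrib[symmetric] mult.commute) (subst sum.swap, simp)

lemma mean_append: "mean K (m + n) f = mean K m (\<lambda>x. mean K n (\<lambda>y. f (x @ y)))"
  by (induction m arbitrary: f) (simp_all add: mean_Suc)

lemma mean_nonneg: "(\<And>w. w \<in> cube K n \<Longrightarrow> 0 \<le> f w) \<Longrightarrow> 0 \<le> mean K n f"
  by (simp add: mean_def sum_nonneg)

lemma mean_le: "K > 0 \<Longrightarrow> (\<And>w. w \<in> cube K n \<Longrightarrow> f w \<le> c) \<Longrightarrow> mean K n f \<le> c"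
  using mean_mono[of K n f "\<lambda>_. c"] by (simp add: mean_const)

lemma mean_ge: "K > 0 \<Longrightarrow> (\<And>w. w \<in> cube K n \<Longrightarrow> c \<le> f w) \<Longrightarrow> c \<le> mean K n f"
  using mean_mono[of K n "\<lambda>_. c" f] by (simp add: mean_const)

lemma mean_attained:
  assumes "K > 0" "c \<le> mean K n f"
  shows "\<exists>w\<in>cube K n. c \<le> f w"
proof (rule ccontr)
  assume "\<not> ?thesis"
  then have less: "\<And>w. w \<in> cube K n \<Longrightarrow> f w < c" by force
  have "cube K n \<noteq> {}" using card_cube[of K n] assms(1) by force
  then have "(\<Sum>w\<in>cube K n. f w) < (\<Sum>w\<in>cube K n. c)"
    by (intro sum_strict_mono less) auto
  then have "mean K n f < mean K n (\<lambda>_. c)"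
    using assms(1) unfolding mean_def by (intro divide_strict_right_mono) auto
  then show False using assms by (simp add: mean_const)
qed

text \<open>The deficits \<open>a - f w\<close> are nonnegative and sum to at most
  \<open>K ^ n * s\<close>, so each single one is at most that.\<close>

lemma mean_lower:
  assumes "K > 0" "\<And>w. w \<in> cube K n \<Longrightarrow> f w \<le> a" "a - s \<le> mean K n f" "w \<in> cube K n"
  shows "a - real K ^ n * s \<le> f w"
proof -
  have "a - f w \<le> (\<Sum>v\<in>cube K n. a - f v)"
    using assms by (intro member_le_sum) auto
  also have "\<dots> = real K ^ n * mean K n (\<lambda>v. a - f v)"
    using assms(1) by (simp add: mean_def)
  also have "\<dots> \<le> real K ^ n * s"
    using assms by (intro mult_left_mono) (auto simp: mean_diff mean_const)
  finally show ?thesis by simp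
qed

section \<open>Densities: Markov and pigeonhole arguments\<close>

lemma dens_nonneg: "0 \<le> dens K n P"
  unfolding dens_def by (rule mean_nonneg) simp

lemma dens_le_1: "K > 0 \<Longrightarrow> dens K n P \<le> 1"
  unfolding dens_def by (rule mean_le) auto

lemma dens_mono: "(\<And>w. w \<in> cube K n \<Longrightarrow> P w \<Longrightarrow> Q w) \<Longrightarrow> dens K n P \<le> dens K n Q"
  unfolding dens_def by (rule mean_mono) auto

lemma dens_append: "dens K (m + n) P = mean K m (\<lambda>x. dens K n (\<lambda>y. P (x @ y)))"
  by (simp add: dens_def mean_append)

lemma dens_markov:
  assumes "K > 0" "\<And>w. w \<in> cube K n \<Longrightarrow> f w \<le> 1" "\<delta> \<le> mean K n f" "0 \<le> \<epsilon>"
  shows "\<delta> - \<epsilon> \<le> dens K n (\<lambda>w. \<epsilon> \<le> f w)"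
proof -
  have "mean K n f \<le> mean K n (\<lambda>w. of_bool (\<epsilon> \<le> f w) + \<epsilon>)"
    using assms by (intro mean_mono) (auto simp: add.commute intro: order_trans[of _ 1])
  then show ?thesis
    using assms by (simp add: mean_add mean_const dens_def)
qed

lemma dens_pigeonhole:
  assumes "finite U" "U \<noteq> {}" "\<delta> \<le> dens K n P"
    and "\<And>w. w \<in> cube K n \<Longrightarrow> P w \<Longrightarrow> \<exists>u\<in>U. Q u w"
  shows "\<exists>u\<in>U. \<delta> / real (card U) \<le> dens K n (Q u)"
proof (rule ccontr)
  assume "\<not> ?thesis"
  then have less: "\<And>u. u \<in> U \<Longrightarrow> dens K n (Q u) < \<delta> / real (card U)" by force
  have "dens K n P \<le> mean K n (\<lambda>w. \<Sum>u\<in>U. of_bool (Q u w))"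
    unfolding dens_def
  proof (rule mean_mono)
    fix w assume "w \<in> cube K n"
    show "(of_bool (P w) :: real) \<le> (\<Sum>u\<in>U. of_bool (Q u w))"
    proof (cases "P w")
      case True
      then obtain u where "u \<in> U" "Q u w" using assms(4) \<open>w \<in> cube K n\<close> by blast
      then show ?thesis
        using member_le_sum[of u U "\<lambda>u. of_bool (Q u w) :: real"] assms(1) True by simp
    qed (simp add: sum_nonneg)
  qed
  also have "\<dots> = (\<Sum>u\<in>U. dens K n (Q u))"
    by (simp add: mean_sum dens_def)
  also have "\<dots> < (\<Sum>u\<in>U. \<delta> / real (card U))"
    using assms less by (intro sum_strict_mono) auto
  also have "\<dots> = \<delta>" using assms by simp
  finally show False using assms(3) by simp
qed

section \<open>Combinatorial subspaces\<close>

text \<open>A word over the letters \<open>0, \<dots>, k + m - 1\<close> encodes a combinatorial subspace: letters below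
  \<open>k\<close> are constants and \<open>k + j\<close> is the \<open>j\<close>-th variable.  The same word can be instantiated with
  words over any alphabet.\<close>

definition inst :: "nat \<Rightarrow> nat list \<Rightarrow> nat list \<Rightarrow> nat list" where
  "inst k V x = map (\<lambda>c. if c < k then c else x ! (c - k)) V"

definition pspace :: "nat \<Rightarrow> nat \<Rightarrow> nat \<Rightarrow> nat list \<Rightarrow> bool" where
  "pspace k m n V \<longleftrightarrow> length V = n \<and> set V \<subseteq> {..<k + m} \<and> {k..<k + m} \<subseteq> set V"

definition has_space :: "nat \<Rightarrow> nat \<Rightarrow> nat \<Rightarrow> (nat list \<Rightarrow> bool) \<Rightarrow> bool" where
  "has_space k m n D \<longleftrightarrow> (\<exists>V. pspace k m n V \<and> (\<forall>x\<in>cube k m. D (inst k V x)))"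

lemma pspace_cube: "pspace k m n V \<Longrightarrow> V \<in> cube (k + m) n"
  by (auto simp: pspace_def cube_def)

lemma inst_cube:
  assumes "V \<in> cube (k + m) n" "x \<in> cube K m" "k \<le> K"
  shows "inst k V x \<in> cube K n"
proof -
  have "x ! (c - k) < K" if "c \<in> set V" "\<not> c < k" for c
  proof -
    have "c < k + m" using assms(1) that by (auto simp: cube_def)
    then show ?thesis using assms(2) that by (intro cube_nth) auto
  qed
  then show ?thesis using assms by (auto simp: inst_def cube_def)
qed

lemma inst_append: "inst k (V @ W) x = inst k V x @ inst k W x"
  by (simp add: inst_def)

lemma inst_const: "t \<in> cube k l \<Longrightarrow> inst k t x = t"
  by (auto simp: inst_def cube_def intro!: map_idI)

lemma inst_inst:
  assumes "V \<in> cube (k + length W) n"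
  shows "inst k V (inst k W x) = inst k (inst k V W) x"
  using assms by (auto simp: inst_def cube_def subset_iff)

lemma pspace_inst:
  assumes V: "pspace k m n V" and W: "pspace k p m W"
  shows "pspace k p n (inst k V W)"
proof -
  have "inst k V W \<in> cube (k + p) n"
    using V W by (intro inst_cube[of V k m]) (auto dest: pspace_cube)
  moreover have "k + i \<in> set (inst k V W)" if "i < p" for i
  proof -
    have "k + i \<in> set W" using W that by (auto simp: pspace_def)
    then obtain j where j: "j < m" "W ! j = k + i"
      using W by (auto simp: in_set_conv_nth pspace_def)
    have "k + j \<in> set V" using V j by (auto simp: pspace_def)
    then show ?thesis using j by (force simp: inst_def)
  qed
  ultimately show ?thesis
    by (auto simp: pspace_def cube_def dest!: le_Suc_ex)
qed

lemma pspace_prefix: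
  "pspace k m n V \<Longrightarrow> t \<in> cube k l \<Longrightarrow> pspace k m (l + n) (t @ V)"
  by (auto simp: pspace_def cube_def)

lemma pspace_suffix:
  "pspace k m n V \<Longrightarrow> t \<in> cube k l \<Longrightarrow> pspace k m (n + l) (V @ t)"
  by (auto simp: pspace_def cube_def)

text \<open>The shift frees the first \<open>d\<close> variables for a subspace put in front, or
  makes room for \<open>d\<close> new letters, turning a subspace over \<open>k\<close> letters into
  one over \<open>k + d\<close>.\<close>

definition vshift :: "nat \<Rightarrow> nat \<Rightarrow> nat list \<Rightarrow> nat list" where
  "vshift k d V = map (\<lambda>c. if c < k then c else c + d) V"

lemma length_vshift [simp]: "length (vshift k d V) = length V"
  by (simp add: vshift_def)

lemma set_vshift:
  assumes "pspace k m n V"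
  shows "set (vshift k d V) \<subseteq> {..<k + d + m}" "{k + d..<k + d + m} \<subseteq> set (vshift k d V)"
proof -
  show "set (vshift k d V) \<subseteq> {..<k + d + m}"
    using assms by (auto simp: vshift_def pspace_def)
  show "{k + d..<k + d + m} \<subseteq> set (vshift k d V)"
  proof
    fix c assume c: "c \<in> {k + d..<k + d + m}"
    then have "c - d \<in> {k..<k + m}" by auto
    then have "c - d \<in> set V" using assms by (auto simp: pspace_def)
    then show "c \<in> set (vshift k d V)"
      using c unfolding vshift_def by (auto simp: image_iff intro!: bexI[of _ "c - d"])
  qed
qed

lemma pspace_append:
  assumes "pspace k m n V" "pspace k m' n' V'"
  shows "pspace k (m + m') (n + n') (V @ vshift k m V')"
proof -
  have "{k..<k + (m + m')} = {k..<k + m} \<union> {k + m..<k + m + m'}" by auto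
  then show ?thesis
    using assms(1) set_vshift[OF assms(2), of m] assms(2) by (auto simp: pspace_def)
qed

lemma inst_vshift_append:
  "length x = d \<Longrightarrow> inst k (vshift k d V) (x @ y) = inst k V y"
  by (auto simp: inst_def vshift_def nth_append)

lemma inst_append_left:
  "pspace k m n V \<Longrightarrow> length x = m \<Longrightarrow> inst k V (x @ y) = inst k V x"
  by (auto simp: inst_def pspace_def nth_append subset_iff)

lemma inst_vshift_lift: "inst (k + d) (vshift k d V) x = inst k V x"
  by (auto simp: inst_def vshift_def)

lemma pspace_vshift: "pspace k m n V \<Longrightarrow> pspace (k + d) m n (vshift k d V)"
  using set_vshift[of k m n V d] by (auto simp: pspace_def add.assoc)

lemma inst_inj:
  assumes "pspace k m n V"
  shows "inj_on (inst k V) (cube K m)"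
proof (rule inj_onI)
  fix x y assume xy: "x \<in> cube K m" "y \<in> cube K m" "inst k V x = inst k V y"
  show "x = y"
  proof (rule nth_equalityI)
    show "length x = length y" using xy by (simp add: cube_length)
    fix i assume "i < length x"
    then have "k + i \<in> set V" using assms xy by (auto simp: pspace_def cube_length)
    then obtain j where "j < length V" "V ! j = k + i" by (auto simp: in_set_conv_nth)
    then show "x ! i = y ! i"
      using arg_cong[OF xy(3), of "\<lambda>w. w ! j"] by (simp add: inst_def)
  qed
qed

lemma has_space_section:
  assumes "has_space k m n (\<lambda>y. D (t @ y))" "t \<in> cube k l"
  shows "has_space k m (l + n) D"
proof -
  obtain V where "pspace k m n V" "\<forall>x\<in>cube k m. D (t @ inst k V x)"
    using assms by (auto simp: has_space_def)
  then show ?thesis unfolding has_space_def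
    by (intro exI[of _ "t @ V"]) (simp add: pspace_prefix assms inst_append inst_const[OF assms(2)])
qed

lemma has_space_section':
  assumes "has_space k m n (\<lambda>x. D (x @ t))" "t \<in> cube k l"
  shows "has_space k m (n + l) D"
proof -
  obtain V where "pspace k m n V" "\<forall>x\<in>cube k m. D (inst k V x @ t)"
    using assms by (auto simp: has_space_def)
  then show ?thesis unfolding has_space_def
    by (intro exI[of _ "V @ t"]) (simp add: pspace_suffix assms inst_append inst_const[OF assms(2)])
qed

lemma has_space_inst:
  assumes V: "pspace k m n V" and "has_space k p m (\<lambda>x. D (inst k V x))"
  shows "has_space k p n D"
proof -
  obtain W where W: "pspace k p m W" "\<forall>x\<in>cube k p. D (inst k V (inst k W x))"
    using assms by (auto simp: has_space_def)
  have "inst k V (inst k W x) = inst k (inst k V W) x" for x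
    using V W by (intro inst_inst[of V k W n]) (auto simp: pspace_def cube_def)
  then show ?thesis unfolding has_space_def
    using W V by (intro exI[of _ "inst k V W"]) (auto intro: pspace_inst)
qed

section \<open>Consequences of the density Hales--Jewett property\<close>

definition dhj_at :: "nat \<Rightarrow> real \<Rightarrow> bool" where
  "dhj_at K \<delta> \<longleftrightarrow> (\<exists>N. \<forall>n\<ge>N. \<forall>D. \<delta> \<le> dens K n D \<longrightarrow> has_space K 1 n D)"

definition DHJ :: "nat \<Rightarrow> bool" where
  "DHJ K \<longleftrightarrow> (\<forall>\<delta>>0. dhj_at K \<delta>)"

lemma has_space_extend:
  assumes "K > 0" and N: "\<And>D. \<delta> \<le> dens K N D \<Longrightarrow> has_space K m N D"
    and "N \<le> n" "\<delta> \<le> dens K n D"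
  shows "has_space K m n D"
proof -
  obtain l where n: "n = N + l" using assms le_Suc_ex by blast
  have "dens K n D = mean K l (\<lambda>y. dens K N (\<lambda>x. D (x @ y)))"
    unfolding n dens_append unfolding dens_def by (rule mean_swap)
  then obtain y where "y \<in> cube K l" "\<delta> \<le> dens K N (\<lambda>x. D (x @ y))"
    using mean_attained[OF assms(1)] assms(4) by metis
  then show ?thesis unfolding n by (intro has_space_section' N)
qed

text \<open>Split words into blocks of length \<open>N\<close> and \<open>M\<close>. By induction
  each prefix with a dense section carries an \<open>m\<close>-dimensional subspace in the second
  block; pigeonholing makes it common to a dense set of prefixes, and a line of such prefixes
  supplies the extra variable.\<close>

lemma DHJ_multidim:
  assumes "DHJ k" "k > 0" "\<delta> > 0"
  shows "\<exists>N. \<forall>n\<ge>N. \<forall>D. \<delta> \<le> dens k n D \<longrightarrow> has_space k m n D"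
  using assms(3)
proof (induction m arbitrary: \<delta>)
  case 0
  have "has_space k 0 n D" if "\<delta> \<le> dens k n D" for n D
  proof -
    obtain w where w: "w \<in> cube k n" "\<delta> \<le> of_bool (D w)"
      using mean_attained[OF assms(2)] \<open>\<delta> \<le> dens k n D\<close> unfolding dens_def by blast
    then have "D w" using 0 by (cases "D w") auto
    then show ?thesis
      using w(1) by (auto simp: has_space_def pspace_def inst_const[OF w(1)] cube_def intro!: exI[of _ w])
  qed
  then show ?case by blast
next
  case (Suc m)
  obtain M where M: "\<And>D. \<delta> / 2 \<le> dens k M D \<Longrightarrow> has_space k m M D"
    using Suc.IH[of "\<delta> / 2"] Suc.prems by auto
  let ?U = "cube (k + m) M"
  have card_U: "real (card ?U) > 0" using assms(2) by (simp add: card_cube)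
  then have "dhj_at k (\<delta> / 2 / real (card ?U))"
    using assms(1) Suc.prems unfolding DHJ_def by simp
  then obtain N where N: "\<And>D. \<delta> / 2 / real (card ?U) \<le> dens k N D \<Longrightarrow> has_space k 1 N D"
    unfolding dhj_at_def by blast
  have "has_space k (Suc m) (N + M) D" if D: "\<delta> \<le> dens k (N + M) D" for D
  proof -
    let ?P = "\<lambda>x. \<delta> / 2 \<le> dens k M (\<lambda>y. D (x @ y))"
    let ?Q = "\<lambda>V x. pspace k m M V \<and> (\<forall>t\<in>cube k m. D (x @ inst k V t))"
    have "\<delta> - \<delta> / 2 \<le> dens k N ?P"
      using D Suc.prems assms(2) by (intro dens_markov) (auto simp: dens_append intro: dens_le_1)
    then have "\<delta> / 2 \<le> dens k N ?P" by simp
    moreover have "\<exists>V\<in>?U. ?Q V x" if "?P x" for x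
      using M[OF that] pspace_cube unfolding has_space_def by blast
    moreover have "?U \<noteq> {}" using card_U by force
    ultimately obtain V where "\<delta> / 2 / real (card ?U) \<le> dens k N (?Q V)"
      using dens_pigeonhole[of ?U "\<delta> / 2" k N ?P ?Q] by auto
    from N[OF this] obtain L where L: "pspace k 1 N L" "\<And>x. x \<in> cube k 1 \<Longrightarrow> ?Q V (inst k L x)"
      unfolding has_space_def by blast
    have "[0] \<in> cube k 1" using assms(2) by (simp add: cube_def)
    then have V: "pspace k m M V" using L by blast
    have "D (inst k (L @ vshift k 1 V) x)" if "x \<in> cube k (Suc m)" for x
    proof -
      obtain a t where x: "x = [a] @ t" "a < k" "t \<in> cube k m"
        using \<open>x \<in> cube k (Suc m)\<close> by (auto simp: cube_Suc)
      have "[a] \<in> cube k 1" using x by (simp add: cube_def)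
      from L(2)[OF this] x have "D (inst k L [a] @ inst k V t)" by blast
      then show ?thesis
        unfolding x(1) inst_append by (simp add: inst_vshift_append inst_append_left[OF L(1)] del: append_Cons)
    qed
    then show ?thesis
      using pspace_append[OF L(1) V] by (auto simp: has_space_def)
  qed
  then show ?case using has_space_extend[OF assms(2)] by blast
qed

text \<open>Double counting: for many \<open>y\<close> the set of \<open>t\<close> with
  \<open>E t y\<close> is dense, hence contains a line, and pigeonholing fixes the line. Only the
  number of candidate lines enters \<open>\<theta>\<close>, so it depends on neither
  \<open>K\<close> nor \<open>l\<close>.\<close>

lemma DHJ_correlation:
  assumes "DHJ k" "k > 0" "\<delta> > 0"
  shows "\<exists>m \<theta>. 0 < \<theta> \<and> (\<forall>K l E. 0 < K \<longrightarrow> (\<forall>t\<in>cube k m. \<delta> \<le> dens K l (E t)) \<longrightarrow>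
    (\<exists>u. pspace k 1 m u \<and> \<theta> \<le> dens K l (\<lambda>y. \<forall>b<k. E (inst k u [b]) y)))"
proof -
  have "dhj_at k (\<delta> / 2)" using assms by (simp add: DHJ_def)
  then obtain m where m: "\<And>D. \<delta> / 2 \<le> dens k m D \<Longrightarrow> has_space k 1 m D"
    unfolding dhj_at_def by blast
  let ?U = "cube (k + 1) m"
  have card_U: "real (card ?U) > 0" by (simp add: card_cube)
  have "\<exists>u. pspace k 1 m u \<and> \<delta> / 2 / real (card ?U) \<le> dens K l (\<lambda>y. \<forall>b<k. E (inst k u [b]) y)"
    if K: "0 < K" and E: "\<forall>t\<in>cube k m. \<delta> \<le> dens K l (E t)" for K l and E :: "nat list \<Rightarrow> nat list \<Rightarrow> bool"
  proof -
    let ?P = "\<lambda>y. \<delta> / 2 \<le> dens k m (\<lambda>t. E t y)"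
    let ?Q = "\<lambda>u y. pspace k 1 m u \<and> (\<forall>b<k. E (inst k u [b]) y)"
    have "\<delta> \<le> mean k m (\<lambda>t. dens K l (E t))"
      using E assms by (intro mean_ge) auto
    also have "\<dots> = mean K l (\<lambda>y. dens k m (\<lambda>t. E t y))"
      unfolding dens_def by (rule mean_swap)
    finally have "\<delta> - \<delta> / 2 \<le> dens K l ?P"
      using K assms by (intro dens_markov) (auto intro: dens_le_1)
    then have "\<delta> / 2 \<le> dens K l ?P" by simp
    moreover have "\<exists>u\<in>?U. ?Q u y" if P: "?P y" for y
    proof -
      from m[OF P] obtain u where "pspace k 1 m u" "\<forall>x\<in>cube k 1. E (inst k u x) y"
        unfolding has_space_def by blast
      then show ?thesis
        using pspace_cube[of k 1 m u] by (intro bexI[of _ u]) (auto simp: cube_def)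
    qed
    moreover have "?U \<noteq> {}" using card_U by force
    ultimately obtain u where u: "\<delta> / 2 / real (card ?U) \<le> dens K l (?Q u)"
      using dens_pigeonhole[of ?U "\<delta> / 2" K l ?P ?Q] by auto
    have "0 < dens K l (?Q u)"
      using u card_U assms(3) by (auto intro: less_le_trans[rotated])
    then have "pspace k 1 m u"
      by (cases "pspace k 1 m u") (auto simp: dens_def mean_def)
    moreover have "dens K l (?Q u) \<le> dens K l (\<lambda>y. \<forall>b<k. E (inst k u [b]) y)"
      by (rule dens_mono) auto
    ultimately show ?thesis using u by force
  qed
  then show ?thesis
    using card_U assms(3) by (intro exI[of _ m] exI[of _ "\<delta> / 2 / real (card ?U)"]) auto
qed

section \<open>Uniform subwords of random words\<close>

text \<open>\<open>tail_prob q M m\<close> is the probability of fewer than \<open>m\<close> successes in \<open>M\<close> independent trials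
  with success probability \<open>q\<close>.\<close>

fun tail_prob :: "real \<Rightarrow> nat \<Rightarrow> nat \<Rightarrow> real" where
  "tail_prob q M 0 = 0"
| "tail_prob q 0 (Suc m) = 1"
| "tail_prob q (Suc M) (Suc m) = q * tail_prob q M m + (1 - q) * tail_prob q M (Suc m)"

lemma tail_prob_le_1: "0 \<le> q \<Longrightarrow> q \<le> 1 \<Longrightarrow> tail_prob q M m \<le> 1"
proof (induction q M m rule: tail_prob.induct)
  case (3 q M m)
  then have "q * tail_prob q M m + (1 - q) * tail_prob q M (Suc m) \<le> q * 1 + (1 - q) * 1"
    by (intro add_mono mult_left_mono) auto
  then show ?case by simp
qed auto

text \<open>Induction on \<open>m\<close>: once the probability for \<open>m\<close> is below
  \<open>\<epsilon> / 2\<close>, each further trial shrinks the bound on the excess over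
  \<open>\<epsilon> / 2\<close> by the factor \<open>1 - q\<close>.\<close>

lemma tail_prob_small:
  assumes "0 < q" "q \<le> 1" "0 < \<epsilon>"
  shows "\<exists>M0. \<forall>M\<ge>M0. tail_prob q M m \<le> \<epsilon>"
  using assms(3)
proof (induction m arbitrary: \<epsilon>)
  case (Suc m)
  obtain M0 where M0: "\<And>M. M \<ge> M0 \<Longrightarrow> tail_prob q M m \<le> \<epsilon> / 2"
    using Suc.IH[of "\<epsilon> / 2"] Suc.prems by auto
  have step: "tail_prob q (M0 + j) (Suc m) \<le> \<epsilon> / 2 + (1 - q) ^ j" for j
  proof (induction j)
    case 0
    then show ?case using tail_prob_le_1[of q M0 "Suc m"] assms Suc.prems by simp
  next
    case (Suc j)
    have "q * tail_prob q (M0 + j) m + (1 - q) * tail_prob q (M0 + j) (Suc m)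
        \<le> q * (\<epsilon> / 2) + (1 - q) * (\<epsilon> / 2 + (1 - q) ^ j)"
      using Suc M0 assms by (intro add_mono mult_left_mono) auto
    also have "\<dots> = \<epsilon> / 2 + (1 - q) ^ Suc j" by (simp add: field_simps)
    finally show ?case by simp
  qed
  obtain J where J: "(1 - q) ^ J < \<epsilon> / 2"
    using real_arch_pow_inv[of "\<epsilon> / 2" "1 - q"] assms Suc.prems by auto
  have "tail_prob q M (Suc m) \<le> \<epsilon>" if M: "M \<ge> M0 + J" for M
  proof -
    obtain i where "M = M0 + (J + i)" using M by (metis add.assoc le_Suc_ex)
    moreover have "(1 - q) ^ (J + i) \<le> (1 - q) ^ J"
      using assms by (intro power_decreasing) auto
    ultimately show ?thesis using step[of "J + i"] J by simp
  qed
  then show ?case by blast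
qed simp

text \<open>A random word over \<open>K\<close> letters can be generated by first revealing the positions whose letter
  lies outside \<open>h ` {..<f}\<close>; the remaining positions are then uniform in \<open>h ` {..<f}\<close>.\<close>

lemma pattern_average:
  fixes \<phi> :: "nat list \<Rightarrow> real"
  assumes "0 < f" and h: "inj_on h {..<f}" "h ` {..<f} \<subseteq> {..<K}" and \<rho>: "0 < \<rho>"
    and "\<And>w. \<phi> w \<le> 1" "\<rho> + tail_prob (real f / real K) M m \<le> mean K M \<phi>"
  shows "\<exists>V. pspace K m M V \<and> \<rho> \<le> mean f m (\<lambda>w. \<phi> (inst K V (map h w)))"
  using assms(5,6)
proof (induction M arbitrary: m \<phi>)
  case (0 m)
  then show ?case
  proof (cases m)
    case 0
    then show ?thesis using "0.prems"(2) by (intro exI[of _ "[]"]) (simp add: pspace_def inst_def)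
  next
    case (Suc m')
    \<comment> \<open>Here \<open>tail_prob\<close> is 1, so the hypotheses would force
      \<open>\<phi> [] > 1\<close>.\<close>
    then show ?thesis using "0.prems"(1)[of "[]"] "0.prems"(2) \<rho> by simp
  qed
next
  case (Suc M m)
  have fK: "f \<le> K" using card_mono[OF _ h(2)] h(1) by (simp add: card_image)
  then have K: "K > 0" using assms(1) by simp
  show ?case
  proof (cases m)
    case 0
    then obtain z where "z \<in> cube K (Suc M)" "\<rho> \<le> \<phi> z"
      using mean_attained[OF K] Suc.prems(2) by (metis add.right_neutral tail_prob.simps(1))
    then show ?thesis
      using 0 by (intro exI[of _ z]) (auto simp: pspace_def cube_def inst_const[of z K "Suc M"])
  next
    case m: (Suc m')
    let ?q = "real f / real K"
    let ?A = "\<lambda>a. mean K M (\<lambda>w. \<phi> (a # w))"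
    let ?\<phi> = "\<lambda>w. (\<Sum>i<f. \<phi> (h i # w)) / real f"
    let ?R = "{..<K} - h ` {..<f}"
    let ?t = "tail_prob ?q M m'" and ?t' = "tail_prob ?q M (Suc m')"
    have mean_\<phi>: "mean L n (\<lambda>w. (\<Sum>i<f. g i w) / real f) = (\<Sum>i<f. mean L n (g i)) / real f"
      for L n and g :: "nat \<Rightarrow> nat list \<Rightarrow> real"
      using mean_cmult[of L n "1 / real f" "\<lambda>w. \<Sum>i<f. g i w"] by (simp add: mean_sum)
    have card_R: "real (card ?R) = real K - real f"
      using h fK by (subst card_Diff_subset) (auto simp: card_image)
    have "(\<Sum>a<K. ?A a) = (\<Sum>a\<in>h ` {..<f}. ?A a) + (\<Sum>a\<in>?R. ?A a)"
      using h(2) by (subst add.commute, intro sum.subset_diff) auto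
    also have "(\<Sum>a\<in>h ` {..<f}. ?A a) = real f * mean K M ?\<phi>"
      using assms(1) h(1) by (simp add: mean_\<phi> sum.reindex)
    finally have split: "(\<Sum>a<K. ?A a) = real f * mean K M ?\<phi> + (\<Sum>a\<in>?R. ?A a)" .
    \<comment> \<open>The first letter lies in the image of \<open>h\<close> with probability
      \<open>f / K\<close>, which matches the recursion of \<open>tail_prob\<close>, so one branch
      keeps its bound. The letter becomes a variable in the first case and the constant
      \<open>a\<close> in the second.\<close>
    consider "\<rho> + ?t \<le> mean K M ?\<phi>" | a where "a \<in> ?R" "\<rho> + ?t' \<le> ?A a"
    proof (rule ccontr)
      assume *: "\<not> thesis"
      then have 1: "mean K M ?\<phi> < \<rho> + ?t" and 2: "\<And>a. a \<in> ?R \<Longrightarrow> ?A a \<le> \<rho> + ?t'"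
        using that by force+
      have "(\<Sum>a<K. ?A a) < real f * (\<rho> + ?t) + (\<Sum>a\<in>?R. \<rho> + ?t')"
        unfolding split using 1 2 assms(1) by (intro add_less_le_mono sum_mono) auto
      also have "\<dots> = real f * (\<rho> + ?t) + (real K - real f) * (\<rho> + ?t')"
        by (simp only: sum_constant card_R)
      also have "\<dots> = real K * (\<rho> + tail_prob ?q (Suc M) m)"
        using K unfolding m by (simp add: field_simps)
      finally show False
        using Suc.prems(2) K by (simp add: mean_Suc field_simps)
    qed
    then show ?thesis
    proof cases
      case 1
      have "?\<phi> w \<le> 1" for w
        using sum_mono[of "{..<f}" "\<lambda>i. \<phi> (h i # w)" "\<lambda>_. 1"] Suc.prems(1) assms(1) by simp
      from Suc.IH[OF this 1] obtain V where V: "pspace K m' M V"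
          "\<rho> \<le> mean f m' (\<lambda>w. ?\<phi> (inst K V (map h w)))" by blast
      have "pspace K 1 1 [K]" by (auto simp: pspace_def)
      then have "pspace K m (Suc M) ([K] @ vshift K 1 V)"
        using pspace_append[of K 1 1 "[K]" m' M V] V m by simp
      moreover have "inst K ([K] @ vshift K 1 V) (map h (i # w)) = h i # inst K V (map h w)" for i w
        using inst_vshift_append[of "[h i]" 1 K V "map h w"] unfolding inst_append by (simp add: inst_def)
      then have "mean f m (\<lambda>w. \<phi> (inst K ([K] @ vshift K 1 V) (map h w)))
          = mean f m' (\<lambda>w. ?\<phi> (inst K V (map h w)))"
        unfolding m mean_Suc mean_\<phi> by simp
      ultimately show ?thesis using V(2) by auto
    next
      case 2
      from Suc.IH[OF _ 2(2)] Suc.prems(1) obtain V where V: "pspace K m M V"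
          "\<rho> \<le> mean f m (\<lambda>w. \<phi> (a # inst K V (map h w)))" unfolding m by blast
      have "[a] \<in> cube K 1" using 2 by (simp add: cube_def)
      from pspace_prefix[OF V(1) this] show ?thesis
        using V(2) 2(1) by (intro exI[of _ "a # V"]) (auto simp: inst_def)
    qed
  qed
qed

section \<open>Insensitive sets\<close>

definition recol :: "nat \<Rightarrow> nat \<Rightarrow> nat list \<Rightarrow> nat list" where
  "recol k b w = map (\<lambda>c. if c = k then b else c) w"

text \<open>Words differing only by exchanges of \<open>k\<close> and \<open>b\<close> have the same
  recolouring, so this single equation encodes invariance under such exchanges.\<close>

definition insens :: "nat \<Rightarrow> nat \<Rightarrow> nat \<Rightarrow> (nat list \<Rightarrow> bool) \<Rightarrow> bool" where
  "insens k b n S \<longleftrightarrow> (\<forall>w\<in>cube (k + 1) n. S (recol k b w) = S w)"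

lemma recol_append: "recol k b (x @ y) = recol k b x @ recol k b y"
  by (simp add: recol_def)

lemma recol_recol: "b < k \<Longrightarrow> recol k c (recol k b w) = recol k b w"
  by (auto simp: recol_def)

lemma recol_cube: "b < k \<Longrightarrow> w \<in> cube (k + 1) n \<Longrightarrow> recol k b w \<in> cube k n"
  by (auto simp: recol_def cube_def subset_iff less_Suc_eq)

lemma recol_cube': "b < k \<Longrightarrow> w \<in> cube (k + 1) n \<Longrightarrow> recol k b w \<in> cube (k + 1) n"
  using recol_cube cube_mono[of k "k + 1" n] by auto

lemma recol_inst:
  assumes "X \<in> cube (k + 1 + m) n" "x \<in> cube (k + 1) m"
  shows "recol k b (inst (k + 1) X (recol k b x)) = recol k b (inst (k + 1) X x)"
  using assms by (auto simp: recol_def inst_def cube_def subset_iff)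

lemma insens_inst:
  assumes "insens k b n S" "b < k" "pspace (k + 1) m n X"
  shows "insens k b m (\<lambda>x. S (inst (k + 1) X x))"
  unfolding insens_def
proof
  fix x assume x: "x \<in> cube (k + 1) m"
  have X: "X \<in> cube (k + 1 + m) n" using assms pspace_cube by blast
  have "inst (k + 1) X x \<in> cube (k + 1) n" "inst (k + 1) X (recol k b x) \<in> cube (k + 1) n"
    using X x recol_cube'[OF assms(2) x] by (auto intro: inst_cube)
  then show "S (inst (k + 1) X (recol k b x)) = S (inst (k + 1) X x)"
    using assms(1) recol_inst[OF X x, of b] unfolding insens_def by metis
qed

lemma insens_section:
  assumes "insens k b (m + n) S" "b < k" "y \<in> cube (k + 1) n"
  shows "insens k b m (\<lambda>x. S (x @ y))"
  unfolding insens_def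
proof
  fix x assume x: "x \<in> cube (k + 1) m"
  have "S (recol k b x @ y) = S (recol k b (recol k b x @ y))"
    using assms(1) append_cube[OF recol_cube'[OF assms(2) x] assms(3)] by (simp add: insens_def)
  also have "\<dots> = S (recol k b (x @ y))" using assms(2) by (simp add: recol_append recol_recol)
  also have "\<dots> = S (x @ y)" using assms x by (simp add: insens_def append_cube)
  finally show "S (recol k b x @ y) = S (x @ y)" .
qed

lemma insens_section':
  assumes "insens k b (m + n) S" "b < k" "x \<in> cube (k + 1) m" "y \<in> cube (k + 1) n"
  shows "S (x @ recol k b y) = S (x @ y)"
proof -
  have "S (x @ recol k b y) = S (recol k b (x @ recol k b y))"
    using assms(1) append_cube[OF assms(3) recol_cube'[OF assms(2,4)]] by (simp add: insens_def)
  also have "\<dots> = S (recol k b (x @ y))" using assms(2) by (simp add: recol_append recol_recol)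
  also have "\<dots> = S (x @ y)" using assms by (simp add: insens_def append_cube)
  finally show ?thesis .
qed

text \<open>On a suitable subspace \<open>S\<close> is still dense among the words over the first
  \<open>k\<close> letters, so it contains a smaller subspace over \<open>k\<close> letters.
  Insensitivity extends this one to the letter \<open>k\<close>, since recolouring gives words over
  \<open>k\<close> letters.\<close>

lemma insens_has_space:
  assumes "DHJ k" "k > 0" "\<epsilon> > 0"
  shows "\<exists>M. \<forall>b<k. \<forall>S. insens k b M S \<longrightarrow> \<epsilon> \<le> dens (k + 1) M S \<longrightarrow> has_space (k + 1) m M S"
proof -
  obtain N where N: "\<And>D. \<epsilon> / 2 \<le> dens k N D \<Longrightarrow> has_space k m N D"
    using DHJ_multidim[OF assms(1,2), of "\<epsilon> / 2" m] assms(3) by auto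
  obtain M where M: "tail_prob (real k / real (k + 1)) M N \<le> \<epsilon> / 2"
    using tail_prob_small[of "real k / real (k + 1)" "\<epsilon> / 2" N] assms by auto
  have "has_space (k + 1) m M S"
    if b: "b < k" and S: "insens k b M S" and d: "\<epsilon> \<le> dens (k + 1) M S" for b S
  proof -
    have "\<exists>V. pspace (k + 1) N M V \<and> \<epsilon> / 2 \<le> mean k N (\<lambda>w. of_bool (S (inst (k + 1) V (map id w))))"
      using assms M d by (intro pattern_average) (auto simp: dens_def)
    then obtain V where V: "pspace (k + 1) N M V" "\<epsilon> / 2 \<le> dens k N (\<lambda>w. S (inst (k + 1) V w))"
      by (auto simp: dens_def)
    obtain U where U: "pspace k m N U" "\<And>t. t \<in> cube k m \<Longrightarrow> S (inst (k + 1) V (inst k U t))"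
      using N[OF V(2)] by (auto simp: has_space_def)
    let ?U = "vshift k 1 U"
    have U': "pspace (k + 1) m N ?U" using U pspace_vshift by blast
    let ?X = "inst (k + 1) V ?U"
    have X: "pspace (k + 1) m M ?X" by (rule pspace_inst[OF V(1) U'])
    have "S (inst (k + 1) ?X x)" if x: "x \<in> cube (k + 1) m" for x
    proof -
      have "inst (k + 1) ?X (recol k b x) = inst (k + 1) V (inst k U (recol k b x))"
        using inst_inst[of V "k + 1" ?U M] pspace_cube[OF V(1)] U' inst_vshift_lift[of k 1 U]
        by (simp add: pspace_def)
      then have "S (inst (k + 1) ?X (recol k b x))" using U(2)[OF recol_cube[OF b x]] by simp
      then show ?thesis using insens_inst[OF S b X] x by (simp add: insens_def)
    qed
    then show ?thesis using X by (auto simp: has_space_def)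
  qed
  then show ?thesis by blast
qed

section \<open>Covering insensitive sets by disjoint subspaces\<close>

lemma mean_image_inst:
  assumes "pspace K m M V" "K > 0"
  shows "mean K M (\<lambda>x. of_bool (x \<in> inst K V ` cube K m) * f x)
    = real K ^ m / real K ^ M * mean K m (\<lambda>x. f (inst K V x))"
proof -
  have sub: "inst K V ` cube K m \<subseteq> cube K M"
    using inst_cube[of V K m M] pspace_cube[OF assms(1)] by auto
  have "(\<Sum>x\<in>cube K M. of_bool (x \<in> inst K V ` cube K m) * f x) = (\<Sum>x\<in>inst K V ` cube K m. f x)"
    using sub by (intro sum.mono_neutral_cong_right) auto
  also have "\<dots> = (\<Sum>x\<in>cube K m. f (inst K V x))"
    using inst_inj[OF assms(1)] by (simp add: sum.reindex)
  finally show ?thesis using assms(2) by (simp add: mean_def)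
qed

lemma pspace_dim_le:
  assumes "pspace k m n V"
  shows "m \<le> n"
proof -
  have "card {k..<k + m} \<le> card (set V)" using assms by (intro card_mono) (auto simp: pspace_def)
  also have "\<dots> \<le> n" using card_length[of V] assms by (simp add: pspace_def)
  finally show ?thesis by simp
qed

text \<open>An insensitive set is covered, up to a small remainder, by disjoint subspaces of dimension
  \<open>m\<close>.  Only the resulting bound on averages is stated: peeling off a block of \<open>M\<close> coordinates
  removes a fraction \<open>q\<close> of the excess of the density of \<open>S\<close> over \<open>e\<close>.\<close>

lemma insens_mean_bound_blocks:
  fixes q e \<sigma> :: real and k m M :: nat
  defines "q \<equiv> real (k + 1) ^ m / real (k + 1) ^ M"
  assumes "b < k" "0 \<le> e" "0 \<le> \<sigma>" "m \<le> M"
    and M: "\<And>S. insens k b M S \<Longrightarrow> e \<le> dens (k + 1) M S \<Longrightarrow> has_space (k + 1) m M S"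
    and "insens k b (j * M + l) S" "\<And>w. g w \<le> 1"
    and "\<And>V. pspace (k + 1) m (j * M + l) V \<Longrightarrow> mean (k + 1) m (\<lambda>x. g (inst (k + 1) V x)) \<le> \<sigma>"
  shows "mean (k + 1) (j * M + l) (\<lambda>w. of_bool (S w) * g w)
    \<le> \<sigma> * dens (k + 1) (j * M + l) S + e + (1 - q) ^ j * (dens (k + 1) (j * M + l) S - e)"
  using assms(7-9)
proof (induction j arbitrary: S g)
  case 0
  have "mean (k + 1) l (\<lambda>w. of_bool (S w) * g w) \<le> dens (k + 1) l S"
    unfolding dens_def using 0 by (intro mean_mono) auto
  moreover have "0 \<le> \<sigma> * dens (k + 1) l S" using assms dens_nonneg by simp
  ultimately show ?case by simp
next
  case (Suc j)
  define K where "K = k + 1"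
  have K: "K > 0" by (simp add: K_def)
  define n where "n = j * M + l"
  have Sn: "Suc j * M + l = M + n" by (simp add: n_def)
  note prems = Suc.prems[unfolded Sn, folded K_def]
  have q: "0 \<le> q" "q \<le> 1"
    using \<open>m \<le> M\<close> unfolding q_def by (auto simp: field_simps intro!: power_increasing)
  define H where "H z \<longleftrightarrow> e \<le> dens K M (\<lambda>x. S (x @ z))" for z
  define V where "V z = (SOME V. pspace K m M V \<and> (\<forall>x\<in>cube K m. S (inst K V x @ z)))" for z
  \<comment> \<open>\<open>U\<close> is a union of disjoint subspaces inside \<open>S\<close>: for
    each \<open>z\<close> with a dense fibre, the chosen \<open>V z\<close> followed by
    \<open>z\<close>.\<close>
  define U where "U x z \<longleftrightarrow> H z \<and> x \<in> inst K (V z) ` cube K m" for x z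
  define S' where "S' x z \<longleftrightarrow> S (x @ z) \<and> \<not> U x z" for x z
  have V: "pspace K m M (V z)" "\<And>x. x \<in> cube K m \<Longrightarrow> S (inst K (V z) x @ z)"
    if "z \<in> cube K n" "H z" for z
  proof -
    have "has_space K m M (\<lambda>x. S (x @ z))"
      using that insens_section[OF prems(1) assms(2)] M unfolding H_def K_def by blast
    then have "\<exists>V. pspace K m M V \<and> (\<forall>x\<in>cube K m. S (inst K V x @ z))" by (simp add: has_space_def)
    from someI_ex[OF this, folded V_def]
    show "pspace K m M (V z)" "\<And>x. x \<in> cube K m \<Longrightarrow> S (inst K (V z) x @ z)" by auto
  qed
  have U_S: "S (x @ z)" if "z \<in> cube K n" "U x z" for x z
    using that V(2) unfolding U_def by blast
  have mean_U: "mean K M (\<lambda>x. of_bool (U x z) * f x) = of_bool (H z) * (q * mean K m (\<lambda>x. f (inst K (V z) x)))"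
    if "z \<in> cube K n" for z f
    using mean_image_inst[OF V(1)[OF that] K] K
    by (cases "H z") (simp_all add: U_def q_def K_def mean_const)
  define u where "u = mean K n (\<lambda>z. mean K M (\<lambda>x. of_bool (U x z)))"
  define d where "d x = dens K n (S' x)" for x
  define D where "D = mean K M d"
  have split: "mean K (M + n) (\<lambda>w. of_bool (S w) * f w) = mean K n (\<lambda>z. mean K M (\<lambda>x. of_bool (U x z) * f (x @ z)))
      + mean K M (\<lambda>x. mean K n (\<lambda>z. of_bool (S' x z) * f (x @ z)))" for f
  proof -
    have "mean K (M + n) (\<lambda>w. of_bool (S w) * f w)
      = mean K M (\<lambda>x. mean K n (\<lambda>z. of_bool (U x z) * f (x @ z) + of_bool (S' x z) * f (x @ z)))"
      unfolding mean_append by (intro mean_cong) (auto simp: S'_def U_S)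
    also have "\<dots> = mean K M (\<lambda>x. mean K n (\<lambda>z. of_bool (U x z) * f (x @ z)))
      + mean K M (\<lambda>x. mean K n (\<lambda>z. of_bool (S' x z) * f (x @ z)))"
      by (simp add: mean_add)
    also have "mean K M (\<lambda>x. mean K n (\<lambda>z. of_bool (U x z) * f (x @ z)))
      = mean K n (\<lambda>z. mean K M (\<lambda>x. of_bool (U x z) * f (x @ z)))"
      by (rule mean_swap)
    finally show ?thesis .
  qed
  have dS: "dens K (M + n) S = u + D"
    using split[of "\<lambda>_. 1"] unfolding u_def D_def d_def[abs_def] dens_def by simp
  have "mean K n (\<lambda>z. mean K M (\<lambda>x. of_bool (U x z) * g (x @ z)))
      \<le> mean K n (\<lambda>z. \<sigma> * mean K M (\<lambda>x. of_bool (U x z)))"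
  proof (rule mean_mono)
    fix z assume z: "z \<in> cube K n"
    have "of_bool (H z) * (q * mean K m (\<lambda>x. g (inst K (V z) x @ z))) \<le> \<sigma> * (of_bool (H z) * (q * 1))"
    proof (cases "H z")
      case True
      have "mean K m (\<lambda>x. g (inst K (V z @ z) x)) \<le> \<sigma>"
        by (rule prems(3)) (use V(1)[OF z True] z in \<open>rule pspace_suffix\<close>)
      then have "mean K m (\<lambda>x. g (inst K (V z) x @ z)) \<le> \<sigma>"
        by (simp add: inst_append inst_const[OF z])
      from mult_left_mono[OF this q(1)] show ?thesis using True by (simp add: mult.commute)
    qed simp
    then show "mean K M (\<lambda>x. of_bool (U x z) * g (x @ z)) \<le> \<sigma> * mean K M (\<lambda>x. of_bool (U x z))"
      using mean_U[OF z, of "\<lambda>x. g (x @ z)"] mean_U[OF z, of "\<lambda>_. 1"] K by (simp add: mean_const)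
  qed
  then have A: "mean K n (\<lambda>z. mean K M (\<lambda>x. of_bool (U x z) * g (x @ z))) \<le> \<sigma> * u"
    by (simp add: mean_cmult u_def)
  have "mean K M (\<lambda>x. mean K n (\<lambda>z. of_bool (S' x z) * g (x @ z)))
      \<le> mean K M (\<lambda>x. \<sigma> * d x + e + (1 - q) ^ j * (d x - e))"
  proof (rule mean_mono)
    fix x assume x: "x \<in> cube K M"
    show "mean K n (\<lambda>z. of_bool (S' x z) * g (x @ z)) \<le> \<sigma> * d x + e + (1 - q) ^ j * (d x - e)"
      unfolding d_def n_def K_def
    proof (rule Suc.IH, fold n_def K_def)
      show "insens k b n (S' x)"
        unfolding insens_def K_def[symmetric]
      proof
        fix z assume z: "z \<in> cube K n"
        have Sz: "S (x @ recol k b z) = S (x @ z)" if "x \<in> cube K M" for x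
          using insens_section'[OF _ assms(2), of M n S x z] prems(1) that z by (simp add: K_def)
        \<comment> \<open>\<open>H z\<close> and the choice \<open>V z\<close> depend on
          \<open>z\<close> only through the fibre of \<open>S\<close> over \<open>z\<close>, which
          recolouring \<open>z\<close> preserves; hence the remainder stays insensitive.\<close>
        have "H (recol k b z) = H z"
          unfolding H_def dens_def using Sz by (simp cong: mean_cong)
        moreover have "S (inst K V x @ recol k b z) = S (inst K V x @ z)"
          if "pspace K m M V" "x \<in> cube K m" for V x
          using that by (intro Sz inst_cube[of V K m]) (auto dest: pspace_cube)
        then have "V (recol k b z) = V z"
          unfolding V_def by (simp cong: conj_cong)
        ultimately show "S' x (recol k b z) = S' x z"
          unfolding S'_def U_def using Sz[OF x] by simp
      qed
      fix V assume "pspace K m n V"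
      then have "mean K m (\<lambda>y. g (inst K (x @ V) y)) \<le> \<sigma>"
        using x by (intro prems(3) pspace_prefix)
      then show "mean K m (\<lambda>y. g (x @ inst K V y)) \<le> \<sigma>"
        by (simp add: inst_append inst_const[OF x])
    qed (rule prems)
  qed
  also have "\<dots> = \<sigma> * D + e + (1 - q) ^ j * (D - e)"
    using K by (simp add: mean_add mean_diff mean_cmult mean_const D_def)
  finally have B: "mean K M (\<lambda>x. mean K n (\<lambda>z. of_bool (S' x z) * g (x @ z)))
      \<le> \<sigma> * D + e + (1 - q) ^ j * (D - e)" .
  have "u = mean K n (\<lambda>z. q * of_bool (H z))"
    unfolding u_def using mean_U[of _ "\<lambda>_. 1"] K by (intro mean_cong) (simp add: mean_const)
  then have "u = q * dens K n H" by (simp add: mean_cmult dens_def)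
  \<comment> \<open>Dense fibres are frequent, so at least the fraction \<open>q\<close> of the
    excess over \<open>e\<close> is removed.\<close>
  moreover have "dens K (M + n) S - e \<le> dens K n H"
    unfolding H_def
  proof (rule dens_markov)
    show "dens K (M + n) S \<le> mean K n (\<lambda>z. dens K M (\<lambda>x. S (x @ z)))"
      unfolding dens_append unfolding dens_def by (rule eq_refl, rule mean_swap)
  qed (use assms K dens_le_1 in auto)
  ultimately have "D - e \<le> (1 - q) * (dens K (M + n) S - e)"
    using mult_left_mono[OF _ q(1), of "dens K (M + n) S - e" "dens K n H"] dS
    by (simp add: algebra_simps)
  then have "(1 - q) ^ j * (D - e) \<le> (1 - q) ^ Suc j * (dens K (M + n) S - e)"
    using mult_left_mono[of _ _ "(1 - q) ^ j"] q by (simp add: mult.assoc mult.commute[of "1 - q"])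
  with A B have "mean K (M + n) (\<lambda>w. of_bool (S w) * g w)
      \<le> \<sigma> * dens K (M + n) S + e + (1 - q) ^ Suc j * (dens K (M + n) S - e)"
    unfolding split dS by (simp add: distrib_left)
  then show ?case unfolding Sn K_def .
qed

lemma insens_mean_bound:
  assumes "DHJ k" "k > 0" "\<epsilon> > 0"
  shows "\<exists>n\<ge>l. \<forall>b<k. \<forall>S g \<sigma>. insens k b n S \<longrightarrow> (\<forall>w. g w \<le> 1) \<longrightarrow> 0 \<le> \<sigma> \<longrightarrow>
    (\<forall>V. pspace (k + 1) m n V \<longrightarrow> mean (k + 1) m (\<lambda>x. g (inst (k + 1) V x)) \<le> \<sigma>) \<longrightarrow>
    mean (k + 1) n (\<lambda>w. of_bool (S w) * g w) \<le> \<sigma> + \<epsilon>"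
proof -
  define e where "e = min (\<epsilon> / 2) 1"
  have e: "0 < e" "e \<le> \<epsilon> / 2" "e \<le> 1" using assms by (auto simp: e_def)
  obtain M where M: "\<And>b S. b < k \<Longrightarrow> insens k b M S \<Longrightarrow> e \<le> dens (k + 1) M S \<Longrightarrow> has_space (k + 1) m M S"
    using insens_has_space[OF assms(1,2) e(1), of m] by blast
  \<comment> \<open>The whole cube is insensitive of density 1, and \<open>e \<le> 1\<close>, so it
    contains an \<open>m\<close>-dimensional subspace; this forces \<open>m \<le> M\<close> and
    hence \<open>q \<le> 1\<close>.\<close>
  have "has_space (k + 1) m M (\<lambda>_. True)"
    using M[of 0 "\<lambda>_. True"] assms e by (simp add: insens_def dens_def mean_const)
  then have mM: "m \<le> M" using pspace_dim_le by (auto simp: has_space_def)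
  define q where "q = real (k + 1) ^ m / real (k + 1) ^ M"
  have q: "0 < q" "q \<le> 1"
    using mM unfolding q_def by (auto simp: field_simps intro!: power_increasing)
  obtain j where j: "(1 - q) ^ j < \<epsilon> / 2"
    using real_arch_pow_inv[of "\<epsilon> / 2" "1 - q"] assms q by auto
  let ?n = "j * M + l"
  have "mean (k + 1) ?n (\<lambda>w. of_bool (S w) * g w) \<le> \<sigma> + \<epsilon>"
    if "b < k" "insens k b ?n S" "\<forall>w. g w \<le> 1" "0 \<le> \<sigma>"
      "\<forall>V. pspace (k + 1) m ?n V \<longrightarrow> mean (k + 1) m (\<lambda>x. g (inst (k + 1) V x)) \<le> \<sigma>" for b S g \<sigma>
  proof -
    let ?d = "dens (k + 1) ?n S"
    have "mean (k + 1) ?n (\<lambda>w. of_bool (S w) * g w) \<le> \<sigma> * ?d + e + (1 - q) ^ j * (?d - e)"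
      unfolding q_def using that e mM M by (intro insens_mean_bound_blocks[where b = b]) auto
    moreover have "\<sigma> * ?d \<le> \<sigma>" using dens_le_1[of "k + 1" ?n S] that mult_left_le by auto
    moreover have "(1 - q) ^ j * (?d - e) \<le> (1 - q) ^ j * 1"
      using dens_le_1[of "k + 1" ?n S] e q by (intro mult_left_mono) auto
    ultimately show ?thesis using e j by simp
  qed
  then show ?thesis by (intro exI[of _ ?n]) auto
qed

text \<open>Cover the last set by subspaces of a dimension \<open>n'\<close> large enough for the
  other \<open>r\<close> sets, which stay insensitive there; each set costs one error
  \<open>\<epsilon>\<close>.\<close>

lemma insens_inter_mean_bound:
  assumes "DHJ k" "k > 0" "\<epsilon> > 0" "r \<le> k"
  shows "\<exists>n\<ge>m. \<forall>S g \<sigma>. (\<forall>i<r. insens k i n (S i)) \<longrightarrow> (\<forall>w. g w \<le> 1) \<longrightarrow> 0 \<le> \<sigma> \<longrightarrow>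
    (\<forall>V. pspace (k + 1) m n V \<longrightarrow> mean (k + 1) m (\<lambda>x. g (inst (k + 1) V x)) \<le> \<sigma>) \<longrightarrow>
    mean (k + 1) n (\<lambda>w. of_bool (\<forall>i<r. S i w) * g w) \<le> \<sigma> + real r * \<epsilon>"
  using assms(4)
proof (induction r)
  case 0
  \<comment> \<open>The word listing all variables in order is the identity embedding, so the
    hypothesis on subspaces bounds the mean of \<open>g\<close> itself.\<close>
  have "pspace (k + 1) m m [k + 1..<k + 1 + m]" by (auto simp: pspace_def)
  moreover have "mean (k + 1) m (\<lambda>x. g (inst (k + 1) [k + 1..<k + 1 + m] x)) = mean (k + 1) m g" for g
    by (intro mean_cong arg_cong[of _ _ g] nth_equalityI) (auto simp: inst_def cube_def simp del: upt_Suc)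
  ultimately have "mean (k + 1) m g \<le> \<sigma>"
    if "\<forall>V. pspace (k + 1) m m V \<longrightarrow> mean (k + 1) m (\<lambda>x. g (inst (k + 1) V x)) \<le> \<sigma>" for g \<sigma>
    using that by metis
  then show ?case by (intro exI[of _ m]) simp
next
  case (Suc r)
  then obtain n' where n': "n' \<ge> m" "\<And>S g \<sigma>. (\<forall>i<r. insens k i n' (S i)) \<Longrightarrow> (\<forall>w. g w \<le> 1) \<Longrightarrow> 0 \<le> \<sigma> \<Longrightarrow>
      (\<forall>V. pspace (k + 1) m n' V \<longrightarrow> mean (k + 1) m (\<lambda>x. g (inst (k + 1) V x)) \<le> \<sigma>) \<Longrightarrow>
      mean (k + 1) n' (\<lambda>w. of_bool (\<forall>i<r. S i w) * g w) \<le> \<sigma> + real r * \<epsilon>"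
    by auto
  obtain n where n: "n \<ge> m" "\<And>b S g \<sigma>. b < k \<Longrightarrow> insens k b n S \<Longrightarrow> (\<forall>w. g w \<le> 1) \<Longrightarrow> 0 \<le> \<sigma> \<Longrightarrow>
      (\<forall>V. pspace (k + 1) n' n V \<longrightarrow> mean (k + 1) n' (\<lambda>x. g (inst (k + 1) V x)) \<le> \<sigma>) \<Longrightarrow>
      mean (k + 1) n (\<lambda>w. of_bool (S w) * g w) \<le> \<sigma> + \<epsilon>"
    using insens_mean_bound[OF assms(1-3), of m n'] by auto
  have "mean (k + 1) n (\<lambda>w. of_bool (\<forall>i<Suc r. S i w) * g w) \<le> \<sigma> + real (Suc r) * \<epsilon>"
    if S: "\<forall>i<Suc r. insens k i n (S i)" and g: "\<forall>w. g w \<le> 1" and \<sigma>: "0 \<le> \<sigma>"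
      and V: "\<forall>V. pspace (k + 1) m n V \<longrightarrow> mean (k + 1) m (\<lambda>x. g (inst (k + 1) V x)) \<le> \<sigma>" for S g \<sigma>
  proof -
    let ?g = "\<lambda>w. of_bool (\<forall>i<r. S i w) * g w"
    have "mean (k + 1) n' (\<lambda>x. ?g (inst (k + 1) X x)) \<le> \<sigma> + real r * \<epsilon>"
      if X: "pspace (k + 1) n' n X" for X
    proof (rule n'(2))
      show "\<forall>i<r. insens k i n' (\<lambda>x. S i (inst (k + 1) X x))"
        using S Suc.prems by (intro allI impI insens_inst[OF _ _ X]) auto
      show "\<forall>V. pspace (k + 1) m n' V \<longrightarrow> mean (k + 1) m (\<lambda>x. g (inst (k + 1) X (inst (k + 1) V x))) \<le> \<sigma>"
      proof (intro allI impI)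
        fix W assume W: "pspace (k + 1) m n' W"
        then show "mean (k + 1) m (\<lambda>x. g (inst (k + 1) X (inst (k + 1) W x))) \<le> \<sigma>"
          using V pspace_inst[OF X W] inst_inst[of X "k + 1" W n] pspace_cube[OF X]
          by (simp add: pspace_def)
      qed
    qed (use g \<sigma> in auto)
    then have "mean (k + 1) n (\<lambda>w. of_bool (S r w) * ?g w) \<le> (\<sigma> + real r * \<epsilon>) + \<epsilon>"
      using S g \<sigma> Suc.prems assms(3) by (intro n(2)[of r]) auto
    moreover have "of_bool (S r w) * ?g w = of_bool (\<forall>i<Suc r. S i w) * g w" for w
      by (auto simp: less_Suc_eq)
    ultimately have "mean (k + 1) n (\<lambda>w. of_bool (\<forall>i<Suc r. S i w) * g w) \<le> (\<sigma> + real r * \<epsilon>) + \<epsilon>"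
      by (simp only:)
    then show ?thesis by (simp add: algebra_simps)
  qed
  then show ?case using n(1) by blast
qed

section \<open>The density Hales--Jewett theorem\<close>

text \<open>Over one letter the cube is a single word, which any set of positive density contains;
  the word of \<open>n \<ge> 1\<close> wildcards is a line with just this point.\<close>

lemma DHJ_1: "DHJ 1"
proof -
  have "has_space 1 1 n D" if \<delta>: "\<delta> > 0" and n: "n \<ge> 1" and D: "\<delta> \<le> dens 1 n D" for \<delta> n D
  proof -
    obtain w where w: "w \<in> cube 1 n" "\<delta> \<le> of_bool (D w)"
      using mean_attained[of 1 \<delta> n "\<lambda>w. of_bool (D w)"] D unfolding dens_def by auto
    then have "D w" using \<delta> by (cases "D w") auto
    have "w = replicate n 0" using w(1) by (auto simp: cube_def intro!: replicate_eqI)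
    then have "inst 1 (replicate n 1) x = w" if "x \<in> cube 1 1" for x
      using cube_nth[OF that, of 0] by (simp add: inst_def map_replicate_const)
    moreover have "pspace 1 1 n (replicate n 1)" using n by (auto simp: pspace_def)
    ultimately show ?thesis using \<open>D w\<close> by (auto simp: has_space_def)
  qed
  then show ?thesis unfolding DHJ_def dhj_at_def by blast
qed

text \<open>A random word \<open>z\<close> over \<open>k + m\<^sub>0\<close> letters is an \<open>m\<^sub>0\<close>-dimensional subspace, and some line \<open>u\<close> of
  it is correlated; pigeonholing fixes \<open>u\<close>.  Under \<open>u\<close> the letters \<open>0, \<dots>, k - 1\<close> and one variable
  of \<open>z\<close> become the \<open>k + 1\<close> letters of the larger alphabet, and their positions become the variables
  of \<open>X\<close>; every other variable of \<open>z\<close> set to the wildcard is merged into the first variable of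
  \<open>X\<close>.\<close>

lemma correlated_subspace:
  assumes "DHJ k" "k > 0" "0 < \<delta>" "\<delta> \<le> 1"
  shows "\<exists>\<theta>>0. \<forall>m. \<exists>M. \<forall>l D. (\<forall>t\<in>cube (k + 1) M. \<delta> \<le> dens (k + 1) l (\<lambda>y. D (t @ y))) \<longrightarrow>
    (\<exists>X. pspace (k + 1) (Suc m) M X \<and> \<theta> \<le> mean (k + 1) l (\<lambda>y. dens (k + 1) (Suc m)
      (\<lambda>x. \<forall>b<k. D (inst (k + 1) X (recol k b x) @ y))))"
proof -
  obtain m0 \<theta>0 where \<theta>0: "0 < \<theta>0" and "\<forall>K l E. 0 < K \<longrightarrow> (\<forall>t\<in>cube k m0. \<delta> \<le> dens K l (E t)) \<longrightarrow>
      (\<exists>u. pspace k 1 m0 u \<and> \<theta>0 \<le> dens K l (\<lambda>y. \<forall>b<k. E (inst k u [b]) y))"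
    using DHJ_correlation[OF assms(1-3)] by (elim exE conjE)
  then have corr: "\<exists>u. pspace k 1 m0 u \<and> \<theta>0 \<le> dens K l (\<lambda>y. \<forall>b<k. E (inst k u [b]) y)"
    if "0 < K" "\<And>t. t \<in> cube k m0 \<Longrightarrow> \<delta> \<le> dens K l (E t)" for K l E
    using that by simp
  \<comment> \<open>Applied to the full family, the correlation yields some line, so
    \<open>m0 \<ge> 1\<close>. Thus \<open>K \<le> L\<close>, and \<open>K / L\<close> is a
    probability.\<close>
  have "\<exists>u. pspace k 1 m0 u"
    using corr[of 1 0 "\<lambda>_ _. True"] assms(4) by (auto simp: dens_def mean_const)
  then have m0: "1 \<le> m0" using pspace_dim_le by blast
  define K where "K = k + 1"
  have K: "K > 0" by (simp add: K_def)
  define L where "L = k + m0"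
  have L: "L > 0" using assms by (simp add: L_def)
  define c where "c = 1 / real (card (cube K m0))"
  have c: "0 < c" using K by (simp add: c_def card_cube)
  \<comment> \<open>\<open>c\<close> pays for fixing \<open>u\<close>, the half for the tail
    probability, and \<open>1 / K\<close> for prescribing \<open>k\<close> as first letter of
    \<open>x\<close>.\<close>
  define \<theta> where "\<theta> = \<theta>0 * (c / 2) / real K"
  have "\<exists>M. \<forall>l D. (\<forall>t\<in>cube K M. \<delta> \<le> dens K l (\<lambda>y. D (t @ y))) \<longrightarrow>
    (\<exists>X. pspace K (Suc m) M X \<and> \<theta> \<le> mean K l (\<lambda>y. dens K (Suc m)
      (\<lambda>x. \<forall>b<k. D (inst K X (recol k b x) @ y))))" for m
  proof -
    obtain M1 where M1: "tail_prob (real K / real L) M1 m \<le> c / 2"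
      using tail_prob_small[of "real K / real L" "c / 2" m] K L m0 c by (auto simp: K_def L_def)
    define M where "M = m0 + M1"
    have "\<exists>X. pspace K (Suc m) M X \<and> \<theta> \<le> mean K l (\<lambda>y. dens K (Suc m)
        (\<lambda>x. \<forall>b<k. D (inst K X (recol k b x) @ y)))"
      if D: "\<forall>t\<in>cube K M. \<delta> \<le> dens K l (\<lambda>y. D (t @ y))" for l D
    proof -
      \<comment> \<open>Repeating \<open>t\<close> in front of \<open>inst k z t\<close> puts
        \<open>u\<close> at the start of \<open>X0\<close>, so the first variable occurs there even
        if \<open>z\<close> lacks variables.\<close>
      define Q where "Q u z \<longleftrightarrow> pspace k 1 m0 u \<and>
        \<theta>0 \<le> dens K l (\<lambda>y. \<forall>b<k. D ((inst k u [b] @ inst k z (inst k u [b])) @ y))" for u z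
      have ex: "\<exists>u\<in>cube K m0. Q u z" if z: "z \<in> cube L M1" for z
      proof -
        have "\<delta> \<le> dens K l (\<lambda>y. D ((t @ inst k z t) @ y))" if t: "t \<in> cube k m0" for t
        proof -
          have "t @ inst k z t \<in> cube k M"
            using t inst_cube[of z k m0 M1 t k] z by (simp add: M_def L_def append_cube)
          then have "t @ inst k z t \<in> cube K M" using cube_mono[of k K M] by (auto simp: K_def)
          then show ?thesis using D by blast
        qed
        then obtain u where "Q u z"
          using corr[OF K, of l "\<lambda>t y. D ((t @ inst k z t) @ y)"] unfolding Q_def by blast
        moreover from this have "u \<in> cube K m0"
          unfolding Q_def K_def by (blast dest: pspace_cube)
        ultimately show ?thesis by blast
      qed
      have "1 \<le> dens L M1 (\<lambda>_. True)" using L by (simp add: dens_def mean_const)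
      moreover have "cube K m0 \<noteq> {}" using c by (auto simp: c_def)
      ultimately obtain u where "u \<in> cube K m0" and u: "c \<le> dens L M1 (Q u)"
        using dens_pigeonhole[of "cube K m0" 1 L M1 "\<lambda>_. True" Q] ex unfolding c_def by auto
      then have "0 < dens L M1 (Q u)" using c by simp
      then have pu: "pspace k 1 m0 u"
        by (cases "pspace k 1 m0 u") (auto simp: dens_def mean_def Q_def)
      then have "k \<in> set u" by (auto simp: pspace_def)
      then obtain i0 where i0: "i0 < m0" "u ! i0 = k"
        using pu by (auto simp: in_set_conv_nth pspace_def)
      have u_nth: "u ! i < k \<or> u ! i = k" if "i < m0" for i
        using cube_nth[OF \<open>u \<in> cube K m0\<close> that] by (auto simp: K_def)
      have len_u: "length u = m0" using pu by (simp add: pspace_def)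
      \<comment> \<open>Since \<open>u\<close> has its wildcard at \<open>i0\<close>, substituting
        \<open>inst k u [b]\<close> turns the letter \<open>k + i0\<close> into \<open>b\<close> and
        keeps letters below \<open>k\<close>: on the letters \<open>h a\<close> this acts as
        \<open>recol k b\<close> does on \<open>a\<close>.\<close>
      define h where "h a = (if a = k then k + i0 else a)" for a
      have "\<exists>V. pspace L m M1 V \<and> c / 2 \<le> mean K m (\<lambda>w. of_bool (Q u (inst L V (map h w))))"
      proof (rule pattern_average)
        show "inj_on h {..<K}" by (auto simp: inj_on_def h_def K_def)
        show "h ` {..<K} \<subseteq> {..<L}" using i0 by (auto simp: h_def K_def L_def)
        show "c / 2 + tail_prob (real K / real L) M1 m \<le> mean L M1 (\<lambda>z. of_bool (Q u z))"
          using M1 u by (simp add: dens_def)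
      qed (use K c in auto)
      then obtain V where V: "pspace L m M1 V"
        and mV: "c / 2 \<le> mean K m (\<lambda>w. of_bool (Q u (inst L V (map h w))))" by blast
      \<comment> \<open>\<open>\<tau>\<close> substitutes \<open>u\<close> for the variables of
        \<open>z\<close>, so that wildcards of \<open>u\<close> become variable 0 of
        \<open>X0\<close>, and renumbers the variables of \<open>V\<close> from 1.\<close>
      define \<tau> where "\<tau> c = (if c < L then if c < k then c else u ! (c - k) else c - L + k + 1)" for c
      define X0 where "X0 = u @ map \<tau> V"
      have \<tau>_less: "\<tau> c < k + Suc m" if "c \<in> set V" for c
      proof -
        have "c < L + m" using that V by (auto simp: pspace_def)
        moreover have "u ! (c - k) \<le> k" if "k \<le> c" "c < L"
        proof -
          have "c - k < m0" using that by (auto simp: L_def)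
          then show ?thesis using u_nth by force
        qed
        ultimately show ?thesis by (force simp: \<tau>_def)
      qed
      have "k + Suc j \<in> set X0" if "j < m" for j
      proof -
        have "L + j \<in> set V" using V that by (auto simp: pspace_def)
        moreover have "\<tau> (L + j) = k + Suc j" by (simp add: \<tau>_def)
        ultimately show ?thesis by (force simp: X0_def)
      qed
      moreover have "k + 0 \<in> set X0" using \<open>k \<in> set u\<close> by (simp add: X0_def)
      ultimately have "k + j \<in> set X0" if "j < Suc m" for j
        using that by (cases j) auto
      then have "{k..<k + Suc m} \<subseteq> set X0"
        by (auto simp: le_iff_add)
      moreover have "set X0 \<subseteq> {..<k + Suc m}"
        using \<tau>_less pu by (auto simp: X0_def pspace_def)
      ultimately have "pspace k (Suc m) M X0"
        using V by (auto simp: pspace_def X0_def M_def len_u)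
      define X where "X = vshift k 1 X0"
      have X: "pspace K (Suc m) M X"
        unfolding X_def K_def by (rule pspace_vshift) fact
      have inst_X: "inst K X x = inst k X0 x" for x
        unfolding X_def K_def by (rule inst_vshift_lift)
      have line: "inst K X (recol k b (k # w)) = inst k u [b] @ inst k (inst L V (map h w)) (inst k u [b])"
        if w: "w \<in> cube K m" and b: "b < k" for w b
      proof -
        have r: "recol k b (k # w) = b # recol k b w" by (simp add: recol_def)
        have "inst k u (b # recol k b w) = inst k u [b]"
          using pu by (auto simp: inst_def pspace_def)
        moreover have "inst k (map \<tau> V) (b # recol k b w) = inst k (inst L V (map h w)) (inst k u [b])"
          unfolding inst_def[of L V] inst_def[of k "map _ V"] map_map
        proof (rule map_cong)
          fix d assume "d \<in> set V"
          then have d: "d < L + m" using V by (auto simp: pspace_def)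
          have iu: "inst k u [b] ! i = (if u ! i < k then u ! i else b)" if "i < m0" for i
            using u_nth[OF that] that len_u by (auto simp: inst_def)
          consider "d < k" | "k \<le> d" "d < L" | "L \<le> d" by linarith
          then show "((\<lambda>c. if c < k then c else (b # recol k b w) ! (c - k)) \<circ> \<tau>) d
            = ((\<lambda>c. if c < k then c else inst k u [b] ! (c - k)) \<circ>
               (\<lambda>c. if c < L then c else map h w ! (c - L))) d"
          proof cases
            case 1
            then show ?thesis by (simp add: \<tau>_def L_def)
          next
            case 2
            then have "d - k < m0" by (auto simp: L_def)
            with 2 u_nth[OF this] iu[OF this] show ?thesis by (auto simp: \<tau>_def)
          next
            case 3
            then have i: "d - L < m" using d by auto
            have wl: "length w = m" using w by (rule cube_length)
            have "w ! (d - L) < k \<or> w ! (d - L) = k"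
              using cube_nth[OF w i] by (auto simp: K_def)
            then show ?thesis
              using 3 i wl iu[OF i0(1)] i0 by (auto simp: \<tau>_def h_def recol_def)
          qed
        qed simp
        ultimately show ?thesis unfolding inst_X r X0_def inst_append by simp
      qed
      let ?G = "\<lambda>x. dens K l (\<lambda>y. \<forall>b<k. D (inst K X (recol k b x) @ y))"
      have "\<theta>0 * (c / 2) \<le> \<theta>0 * mean K m (\<lambda>w. of_bool (Q u (inst L V (map h w))))"
        using mV \<theta>0 by (intro mult_left_mono) auto
      also have "\<dots> = mean K m (\<lambda>w. \<theta>0 * of_bool (Q u (inst L V (map h w))))"
        by (simp add: mean_cmult)
      also have "\<dots> \<le> mean K m (\<lambda>w. ?G (k # w))"
      proof (rule mean_mono)
        fix w assume "w \<in> cube K m"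
        then have "?G (k # w) = dens K l (\<lambda>y. \<forall>b<k. D ((inst k u [b] @
            inst k (inst L V (map h w)) (inst k u [b])) @ y))"
          using line by simp
        then show "\<theta>0 * of_bool (Q u (inst L V (map h w))) \<le> ?G (k # w)"
          using dens_nonneg by (auto simp: Q_def)
      qed
      also have "\<dots> \<le> (\<Sum>a<K. mean K m (\<lambda>w. ?G (a # w)))"
        by (rule member_le_sum) (auto simp: K_def intro!: mean_nonneg dens_nonneg)
      finally have "\<theta> \<le> mean K (Suc m) ?G"
        unfolding mean_Suc \<theta>_def by (intro divide_right_mono) auto
      also have "\<dots> = mean K l (\<lambda>y. dens K (Suc m) (\<lambda>x. \<forall>b<k. D (inst K X (recol k b x) @ y)))"
        unfolding dens_def by (rule mean_swap)
      finally show ?thesis using X by blast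
    qed
    then show ?thesis by blast
  qed
  moreover have "0 < \<theta>" using \<theta>0 c K by (simp add: \<theta>_def)
  ultimately show ?thesis unfolding K_def by blast
qed

section \<open>Density increment and induction on the alphabet\<close>

lemma sum_of_bool_first_failure:
  fixes k :: nat
  shows "(\<Sum>j<k. of_bool ((\<forall>i<j. A i) \<and> \<not> A j) :: real) = of_bool (\<not> (\<forall>i<k. A i))"
  by (induction k) (auto simp: less_Suc_eq)

lemma dens_cube: "k \<le> K \<Longrightarrow> dens K n (\<lambda>x. x \<in> cube k n) = (real k / real K) ^ n"
proof -
  assume "k \<le> K"
  then have "cube K n \<inter> cube k n = cube k n" using cube_mono by blast
  then show ?thesis
    by (simp add: dens_def mean_def of_bool_def sum.If_cases card_cube power_divide)
qed

text \<open>If \<open>D\<close> has no line, it avoids (up to words without the letter \<open>k\<close>) the set of words all of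
  whose recolourings lie in \<open>D\<close>.  On the complement, a union of \<open>k\<close> disjoint intersections of
  insensitive sets, \<open>D\<close> cannot be denser than on subspaces.\<close>

lemma line_free_bound:
  assumes no_line: "\<not> has_space (k + 1) 1 n D" and "0 \<le> \<Delta>"
    and sub: "\<And>V. pspace (k + 1) m n V \<Longrightarrow> dens (k + 1) m (\<lambda>x. D (inst (k + 1) V x)) \<le> \<Delta> + \<sigma>"
    and bound: "\<And>S g. (\<forall>i<k. insens k i n (S i)) \<Longrightarrow> (\<forall>w. g w \<le> 1) \<Longrightarrow>
      (\<forall>V. pspace (k + 1) m n V \<longrightarrow> mean (k + 1) m (\<lambda>x. g (inst (k + 1) V x)) \<le> \<sigma>) \<Longrightarrow>
      mean (k + 1) n (\<lambda>w. of_bool (\<forall>i<k. S i w) * g w) \<le> \<tau>"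
  shows "dens (k + 1) n D - \<Delta> * (1 - dens (k + 1) n (\<lambda>x. \<forall>b<k. D (recol k b x)))
    \<le> real k * \<tau> + (real k / real (k + 1)) ^ n"
proof -
  define K where "K = k + 1"
  have K: "K > 0" by (simp add: K_def)
  let ?g = "\<lambda>x. of_bool (D x) - \<Delta> :: real"
  let ?A = "\<lambda>i x. D (recol k i x)"
  let ?S = "\<lambda>x. \<forall>i<k. ?A i x"
  have piece: "mean K n (\<lambda>x. of_bool ((\<forall>i<j. ?A i x) \<and> \<not> ?A j x) * ?g x) \<le> \<tau>" if j: "j < k" for j
  proof -
    \<comment> \<open>Piece \<open>j\<close> consists of the words whose first failing recolouring
      is \<open>j\<close>; for \<open>i > j\<close> the condition is trivially true, which pads the
      family to \<open>k\<close> sets as \<open>bound\<close> requires.\<close>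
    let ?T = "\<lambda>i x. (i < j \<longrightarrow> ?A i x) \<and> (i = j \<longrightarrow> \<not> ?A i x)"
    have "mean K n (\<lambda>x. of_bool (\<forall>i<k. ?T i x) * ?g x) \<le> \<tau>"
      unfolding K_def
    proof (rule bound)
      show "\<forall>i<k. insens k i n (?T i)" by (simp add: insens_def recol_recol)
      show "\<forall>w. ?g w \<le> 1" using assms by simp
      show "\<forall>V. pspace (k + 1) m n V \<longrightarrow> mean (k + 1) m (\<lambda>x. ?g (inst (k + 1) V x)) \<le> \<sigma>"
        using sub by (simp add: mean_diff mean_const dens_def algebra_simps)
    qed
    moreover have "(\<forall>i<k. ?T i x) \<longleftrightarrow> (\<forall>i<j. ?A i x) \<and> \<not> ?A j x" for x
      using j by auto
    ultimately show ?thesis by simp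
  qed
  \<comment> \<open>If \<open>k\<close> occurs in \<open>x\<close>, turning every \<open>k\<close>
    into a wildcard gives a line whose points are the recolourings of \<open>x\<close> and
    \<open>x\<close> itself.\<close>
  have D_S: "x \<in> cube k n" if x: "x \<in> cube K n" "D x" "?S x" for x
  proof (rule ccontr)
    assume "x \<notin> cube k n"
    then have "k \<in> set x" using x(1) by (force simp: cube_def K_def subset_iff less_Suc_eq)
    then have "pspace k 1 n x" using x(1) by (auto simp: pspace_def cube_def K_def)
    then have "pspace (k + 1) 1 n (vshift k 1 x)" by (rule pspace_vshift)
    moreover have "D (inst (k + 1) (vshift k 1 x) y)" if "y \<in> cube (k + 1) 1" for y
    proof -
      obtain a where y: "y = [a]" "a < k + 1" using \<open>y \<in> cube (k + 1) 1\<close> by (auto simp: cube_Suc)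
      have "inst k x [a] = recol k a x"
        using x(1) by (auto simp: inst_def recol_def cube_def K_def subset_iff less_Suc_eq)
      moreover have "recol k k x = x" by (simp add: recol_def)
      ultimately show ?thesis
        using y x unfolding inst_vshift_lift y(1) by (auto simp: less_Suc_eq)
    qed
    ultimately show False using no_line unfolding has_space_def by blast
  qed
  have "dens K n D - dens K n (\<lambda>x. x \<in> cube k n) - \<Delta> * (1 - dens K n ?S)
    = mean K n (\<lambda>x. of_bool (D x) - of_bool (x \<in> cube k n) - \<Delta> * (1 - of_bool (?S x)))"
    using K by (simp add: mean_diff mean_cmult mean_const dens_def)
  also have "\<dots> \<le> mean K n (\<lambda>x. of_bool (\<not> ?S x) * ?g x)"
  proof (rule mean_mono)
    fix x assume "x \<in> cube K n"
    then show "of_bool (D x) - of_bool (x \<in> cube k n) - \<Delta> * (1 - of_bool (?S x))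
        \<le> of_bool (\<not> ?S x) * ?g x"
      using D_S[of x] by (cases "?S x"; cases "D x") auto
  qed
  also have "\<dots> = (\<Sum>j<k. mean K n (\<lambda>x. of_bool ((\<forall>i<j. ?A i x) \<and> \<not> ?A j x) * ?g x))"
    unfolding mean_sum[symmetric] sum_distrib_right[symmetric] sum_of_bool_first_failure ..
  also have "\<dots> \<le> (\<Sum>j<k. \<tau>)" by (rule sum_mono) (use piece in simp)
  finally show ?thesis using dens_cube[of k K n] by (simp add: K_def)
qed

text \<open>The choices run \<open>\<theta>\<close>, \<open>\<gamma>\<close>, \<open>p\<close>,
  \<open>n1\<close>, \<open>M\<close> and last \<open>\<eta>\<close>, which must beat
  \<open>K ^ M\<close>; this works because \<open>\<theta>\<close> depends on no dimension.\<close>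

lemma DHJ_Suc:
  assumes DHJ: "DHJ k" and k: "k > 0"
  shows "DHJ (k + 1)"
proof (rule ccontr)
  define K where "K = k + 1"
  have K: "K > 0" "k + 1 = K" by (simp_all add: K_def)
  assume "\<not> DHJ (k + 1)"
  then obtain \<delta>1 where \<delta>1: "\<delta>1 > 0" "\<not> dhj_at K \<delta>1" by (auto simp: DHJ_def K_def)
  define G where "G = {\<delta>. 0 < \<delta> \<and> dhj_at K \<delta>}"
  have mono: "dhj_at K b" if "dhj_at K a" "a \<le> b" for a b
    using that unfolding dhj_at_def by (meson order_trans)
  have "\<not> 2 \<le> dens K n D" for n D using dens_le_1[OF K(1), of n D] by simp
  \<comment> \<open>Densities never reach 2, so the property holds vacuously and \<open>G\<close> is
    nonempty.\<close>
  then have "2 \<in> G" by (simp add: G_def dhj_at_def)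
  have G_lower: "\<delta>1 \<le> \<delta>" if "\<delta> \<in> G" for \<delta>
    using that mono[of \<delta> \<delta>1] \<delta>1(2) unfolding G_def by (cases "\<delta>1 \<le> \<delta>") auto
  define \<Delta> where "\<Delta> = Inf G"
  have "bdd_below G" using G_lower by (auto simp: bdd_below_def)
  have "\<delta>1 \<le> \<Delta>" unfolding \<Delta>_def using \<open>2 \<in> G\<close> G_lower by (intro cInf_greatest) auto
  then have \<Delta>: "0 < \<Delta>" using \<delta>1 by simp
  have \<Delta>2: "\<Delta> \<le> 2" unfolding \<Delta>_def using \<open>2 \<in> G\<close> \<open>bdd_below G\<close> by (rule cInf_lower)
  have above: "dhj_at K (\<Delta> + \<eta>)" if \<eta>: "\<eta> > 0" for \<eta>
  proof -
    have "G \<noteq> {}" using \<open>2 \<in> G\<close> by blast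
    then obtain \<delta> where "\<delta> \<in> G" "\<delta> < \<Delta> + \<eta>"
      using cInf_lessD[of G "\<Delta> + \<eta>"] \<eta> unfolding \<Delta>_def by auto
    then show ?thesis using mono unfolding G_def by force
  qed
  have below: "\<not> dhj_at K \<delta>" if "0 < \<delta>" "\<delta> < \<Delta>" for \<delta>
    using that cInf_lower[of \<delta> G] \<open>bdd_below G\<close> unfolding \<Delta>_def G_def by force
  obtain \<theta> where \<theta>: "\<theta> > 0" and corr: "\<And>m. \<exists>M. \<forall>l D. (\<forall>t\<in>cube K M. \<Delta> / 2 \<le> dens K l (\<lambda>y. D (t @ y))) \<longrightarrow>
    (\<exists>X. pspace K (Suc m) M X \<and> \<theta> \<le> mean K l (\<lambda>y. dens K (Suc m)
      (\<lambda>x. \<forall>b<k. D (inst K X (recol k b x) @ y))))"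
    using correlated_subspace[OF DHJ k, of "\<Delta> / 2"] \<Delta> \<Delta>2 unfolding K(2) by auto
  \<comment> \<open>Each of the \<open>k\<close> pieces costs \<open>\<gamma>\<close> for the
    density on subspaces and \<open>\<gamma>\<close> for the covering, in total
    \<open>\<Delta> * \<theta> / 2\<close>.\<close>
  define \<gamma> where "\<gamma> = \<Delta> * \<theta> / (4 * real k)"
  have \<gamma>: "\<gamma> > 0" using \<Delta> \<theta> k by (simp add: \<gamma>_def)
  obtain N1 where N1: "\<And>n D. n \<ge> N1 \<Longrightarrow> \<Delta> + \<gamma> \<le> dens K n D \<Longrightarrow> has_space K 1 n D"
    using above[OF \<gamma>] unfolding dhj_at_def by blast
  obtain N0 where N0: "(real k / real K) ^ N0 < \<Delta> * \<theta> / 8"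
    using real_arch_pow_inv[of "\<Delta> * \<theta> / 8" "real k / real K"] \<Delta> \<theta> by (auto simp: K_def)
  \<comment> \<open>\<open>N1\<close> yields a line in any \<open>p\<close>-dimensional subspace of
    density at least \<open>\<Delta> + \<gamma>\<close>, \<open>N0\<close> makes words without the
    letter \<open>k\<close> rare, and 1 ensures \<open>n1 > 0\<close>.\<close>
  define p where "p = max 1 (max N0 N1)"
  obtain n1 where n1: "n1 \<ge> p" and cover: "\<And>S g \<sigma>. (\<forall>i<k. insens k i n1 (S i)) \<Longrightarrow> (\<forall>w. g w \<le> 1) \<Longrightarrow> 0 \<le> \<sigma> \<Longrightarrow>
    (\<forall>V. pspace K p n1 V \<longrightarrow> mean K p (\<lambda>x. g (inst K V x)) \<le> \<sigma>) \<Longrightarrow>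
    mean K n1 (\<lambda>w. of_bool (\<forall>i<k. S i w) * g w) \<le> \<sigma> + real k * (\<gamma> / real k)"
    using insens_inter_mean_bound[OF DHJ k, of "\<gamma> / real k" k p] \<gamma> k unfolding K(2) by auto
  obtain m where m: "n1 = Suc m" using n1 by (cases n1) (auto simp: p_def)
  have small: "(real k / real K) ^ n1 \<le> \<Delta> * \<theta> / 8"
  proof -
    have "(real k / real K) ^ n1 \<le> (real k / real K) ^ N0"
      using n1 by (intro power_decreasing) (auto simp: p_def K_def)
    then show ?thesis using N0 by simp
  qed
  obtain M where M: "\<And>l D. (\<And>t. t \<in> cube K M \<Longrightarrow> \<Delta> / 2 \<le> dens K l (\<lambda>y. D (t @ y))) \<Longrightarrow>
    \<exists>X. pspace K n1 M X \<and> \<theta> \<le> mean K l (\<lambda>y. dens K n1 (\<lambda>x. \<forall>b<k. D (inst K X (recol k b x) @ y)))"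
    using corr[of m] unfolding m by blast
  \<comment> \<open>\<open>\<Delta> / 4\<close> keeps all sections above
    \<open>\<Delta> / 2\<close>, as the correlation needs; \<open>\<Delta> * \<theta> / 8\<close>
    stays below the final gain.\<close>
  define \<beta> where "\<beta> = min (\<Delta> / 4) (\<Delta> * \<theta> / 8)"
  have \<beta>: "0 < \<beta>" "\<beta> \<le> \<Delta> / 4" "\<beta> \<le> \<Delta> * \<theta> / 8" using \<Delta> \<theta> by (auto simp: \<beta>_def)
  \<comment> \<open>Sections have density at most \<open>\<Delta> + \<eta>\<close> and average at
    least \<open>\<Delta> - \<eta>\<close>, so none falls more than
    \<open>K ^ M * (2 * \<eta>) = \<beta>\<close> below \<open>\<Delta> + \<eta>\<close>.\<close>
  define \<eta> where "\<eta> = \<beta> / (2 * real K ^ M)"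
  have "1 \<le> real K ^ M" using K by simp
  then have "\<beta> * 1 \<le> \<beta> * (2 * real K ^ M)" using \<beta> by (intro mult_left_mono) auto
  then have \<eta>: "0 < \<eta>" "\<eta> \<le> \<beta>" "real K ^ M * (2 * \<eta>) = \<beta>"
    using \<beta> K unfolding \<eta>_def by (auto simp: divide_le_eq)
  obtain N2 where N2: "\<And>n D. n \<ge> N2 \<Longrightarrow> \<Delta> + \<eta> \<le> dens K n D \<Longrightarrow> has_space K 1 n D"
    using above[OF \<eta>(1)] unfolding dhj_at_def by blast
  have "has_space K 1 n D" if n: "n \<ge> M + N2" and D: "\<Delta> - \<eta> \<le> dens K n D" for n D
  proof (rule ccontr)
    assume no_line: "\<not> has_space K 1 n D"
    obtain l where l: "n = M + l" "l \<ge> N2" using n by (metis add.assoc le_Suc_ex le_add1)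
    have "dens K l (\<lambda>y. D (t @ y)) \<le> \<Delta> + \<eta>" if "t \<in> cube K M" for t
      using N2[OF l(2)] has_space_section[OF _ that] no_line unfolding l(1) by force
    then have "\<Delta> + \<eta> - real K ^ M * (2 * \<eta>) \<le> dens K l (\<lambda>y. D (t @ y))" if "t \<in> cube K M" for t
      using K D that unfolding l(1) dens_append by (intro mean_lower[where a = "\<Delta> + \<eta>"]) auto
    then have lower: "\<Delta> - \<beta> \<le> dens K l (\<lambda>y. D (t @ y))" if "t \<in> cube K M" for t
      using that \<eta> by force
    then have "\<Delta> / 2 \<le> dens K l (\<lambda>y. D (t @ y))" if "t \<in> cube K M" for t
      using that \<beta> \<Delta> by force
    from M[OF this] obtain X where X: "pspace K n1 M X"
      and corrX: "\<theta> \<le> mean K l (\<lambda>y. dens K n1 (\<lambda>x. \<forall>b<k. D (inst K X (recol k b x) @ y)))"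
      by blast
    let ?D = "\<lambda>y x. D (inst K X x @ y)"
    let ?d = "\<lambda>y. dens K n1 (?D y)" and ?s = "\<lambda>y. dens K n1 (\<lambda>x. \<forall>b<k. ?D y (recol k b x))"
    have "?d y - \<Delta> * (1 - ?s y) \<le> \<Delta> * \<theta> * (5 / 8)" if y: "y \<in> cube K l" for y
    proof -
      have no: "\<not> has_space K 1 n1 (?D y)"
        using has_space_inst[OF X, of 1 "\<lambda>w. D (w @ y)"] has_space_section'[OF _ y, of 1 M D] no_line
        unfolding l(1) by blast
      have "?d y - \<Delta> * (1 - ?s y) \<le> real k * (\<gamma> + real k * (\<gamma> / real k)) + (real k / real K) ^ n1"
        unfolding K(2)[symmetric]
      proof (rule line_free_bound[where \<sigma> = \<gamma> and m = p], unfold K(2))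
        fix V assume V: "pspace K p n1 V"
        have "\<not> has_space K 1 p (\<lambda>x. ?D y (inst K V x))"
          using has_space_inst[OF V, of 1 "?D y"] no by blast
        then show "dens K p (\<lambda>x. ?D y (inst K V x)) \<le> \<Delta> + \<gamma>"
          using N1[of p "\<lambda>x. ?D y (inst K V x)"] by (force simp: p_def)
      qed (use no \<Delta> \<gamma> cover in auto)
      also have "real k * (\<gamma> + real k * (\<gamma> / real k)) = \<Delta> * \<theta> / 2"
        using k by (simp add: \<gamma>_def)
      finally show ?thesis using small by simp
    qed
    then have "mean K l (\<lambda>y. ?d y - \<Delta> * (1 - ?s y)) \<le> \<Delta> * \<theta> * (5 / 8)"
      by (intro mean_le K)
    then have upper: "mean K l ?d - \<Delta> * (1 - mean K l ?s) \<le> \<Delta> * \<theta> * (5 / 8)"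
      using K by (simp add: mean_diff mean_cmult mean_const)
    have "\<Delta> - \<beta> \<le> mean K n1 (\<lambda>x. dens K l (\<lambda>y. ?D y x))"
      using K inst_cube[OF pspace_cube[OF X]] by (intro mean_ge lower) auto
    also have "\<dots> = mean K l ?d" unfolding dens_def by (rule mean_swap)
    finally have "\<Delta> - \<beta> \<le> mean K l ?d" .
    moreover have "\<Delta> * \<theta> \<le> \<Delta> * mean K l ?s" using corrX \<Delta> by simp
    moreover have "0 < \<Delta> * \<theta>" using \<Delta> \<theta> by simp
    \<comment> \<open>The mean density of \<open>D\<close> on the copies of \<open>X\<close> is at
      least \<open>\<Delta> - \<Delta> * \<theta> / 8\<close>, but at most
      \<open>\<Delta> - \<Delta> * \<theta> * (3 / 8)\<close>.\<close>
    ultimately show False using upper \<beta>(3) by (simp add: algebra_simps)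
  qed
  then have "dhj_at K (\<Delta> - \<eta>)" unfolding dhj_at_def by blast
  moreover have "0 < \<Delta> - \<eta>" using \<eta> \<beta> \<Delta> by simp
  ultimately show False using below \<eta> by simp
qed

theorem density_Hales_Jewett: "k > 0 \<Longrightarrow> DHJ k"
  by (induction k rule: nat_induct_non_zero) (use DHJ_1 DHJ_Suc in auto)

section \<open>Measures on the cube\<close>

lemma comb_line_inst:
  assumes L: "pspace k 1 n L" and "n \<ge> 1" "k \<ge> 1"
  shows "comb_line k (\<lambda>v. map Suc (inst k L [v - 1]))"
  unfolding comb_line_def
proof (intro exI conjI ballI)
  \<comment> \<open>Letters shift from \<open>{..<k}\<close> to \<open>{1..k}\<close> and positions
    start at 1. On \<open>?I\<close> the base word holds the dummy letter 1, which
    \<open>line_word\<close> replaces by \<open>v\<close>.\<close>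
  let ?w = "map Suc (inst k L [0])" and ?I = "{m\<in>{1..n}. L ! (m - 1) = k}"
  have len: "length L = n" and le: "\<And>c. c \<in> set L \<Longrightarrow> c \<le> k" and "k \<in> set L"
    using L by (auto simp: pspace_def)
  show "n \<ge> 1" by fact
  show "?I \<subseteq> {1..n}" by auto
  show "length ?w = n" using len by (simp add: inst_def)
  obtain i where "i < n" "L ! i = k" using \<open>k \<in> set L\<close> len by (auto simp: in_set_conv_nth)
  then have "Suc i \<in> ?I" by auto
  then show "?I \<noteq> {}" by blast
  show "set ?w \<subseteq> {1..k}" using assms le by (auto simp: inst_def)
  fix v assume v: "v \<in> {1..k}"
  show "map Suc (inst k L [v - 1]) = line_word n ?I ?w v"
  proof (rule nth_equalityI)
    show "length (map Suc (inst k L [v - 1])) = length (line_word n ?I ?w v)"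
      using len by (simp add: inst_def line_word_def)
    fix i assume "i < length (map Suc (inst k L [v - 1]))"
    then have i: "i < n" using len by (simp add: inst_def)
    then have "L ! i \<le> k" using len by (auto intro: le)
    then show "map Suc (inst k L [v - 1]) ! i = line_word n ?I ?w v ! i"
      using i v len by (auto simp: inst_def line_word_def simp del: upt_Suc)
  qed
qed

theorem theorem5p1:
  fixes k :: nat and \<delta> :: real and \<mu> :: "(nat list \<Rightarrow> bool) measure"
  assumes "k \<ge> 1" and "\<delta> > 0"
    and "prob_space \<mu>"
    and "sets \<mu> = sets (cube_measure k)"
    and "\<forall>w\<in>words k. measure \<mu> {x \<in> space \<mu>. x w} \<ge> \<delta>"
  shows "\<exists>\<phi>. comb_line k \<phi> \<and> measure \<mu> {x \<in> space \<mu>. \<forall>i\<in>{1..k}. x (\<phi> i)} > 0"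
proof (rule ccontr)
  assume no: "\<not> ?thesis"
  interpret prob_space \<mu> by fact
  have null: "\<not> 0 < prob {x \<in> space \<mu>. \<forall>i\<in>{1..k}. x (\<phi> i)}" if "comb_line k \<phi>" for \<phi>
    using no that by blast
  have "dhj_at k (\<delta> / 2)"
    using density_Hales_Jewett[of k] assms by (simp add: DHJ_def)
  then obtain N where N: "\<And>n D. n \<ge> N \<Longrightarrow> \<delta> / 2 \<le> dens k n D \<Longrightarrow> has_space k 1 n D"
    unfolding dhj_at_def by blast
  define n where "n = max N 1"
  have n: "n \<ge> N" "n \<ge> 1" by (auto simp: n_def)
  define A where "A w = {x \<in> space \<mu>. x w}" for w
  have A_sets: "A w \<in> sets \<mu>" if "w \<in> words k" for w
  proof -
    have "(\<lambda>x. x w) \<in> \<mu> \<rightarrow>\<^sub>M count_space UNIV"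
      using measurable_component_singleton[OF that, of "\<lambda>_. count_space (UNIV :: bool set)"]
        measurable_cong_sets[OF \<open>sets \<mu> = sets (cube_measure k)\<close> refl] unfolding cube_measure_def by blast
    from measurable_sets[OF this, of "{True}"] show ?thesis
      by (simp add: A_def vimage_def Int_def conj_commute)
  qed
  have words: "map Suc w \<in> words k" if "w \<in> cube k n" for w
    using that n by (auto simp: words_def cube_def)
  \<comment> \<open>\<open>f x\<close> is the density of the set of words of length \<open>n\<close>
    selected by \<open>x\<close>; its expectation averages the probabilities of the
    coordinates.\<close>
  define f where "f x = mean k n (\<lambda>w. indicator (A (map Suc w)) x)" for x
  have int: "integrable \<mu> (\<lambda>x. indicator (A (map Suc w)) x :: real)" if "w \<in> cube k n" for w
    using A_sets[OF words[OF that]] by (simp add: emeasure_eq_measure)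
  have int_f: "integrable \<mu> f"
    unfolding f_def mean_def using int by auto
  have "expectation f = mean k n (\<lambda>w. prob (A (map Suc w)))"
    unfolding f_def mean_def using int A_sets words sets.sets_into_space
    by (simp add: Bochner_Integration.integral_sum Int_absorb1)
  also have "\<dots> \<ge> \<delta>"
    using assms words by (intro mean_ge) (auto simp: A_def)
  finally have ge: "\<delta> \<le> expectation f" .
  have "AE x in \<mu>. \<not> (\<forall>i\<in>{1..k}. x (map Suc (inst k L [i - 1])))" if L: "pspace k 1 n L" for L
  proof -
    let ?E = "{x \<in> space \<mu>. \<forall>i\<in>{1..k}. x (map Suc (inst k L [i - 1]))}"
    have "map Suc (inst k L [i - 1]) \<in> words k" if "i \<in> {1..k}" for i
      using that by (intro words inst_cube[OF pspace_cube[OF L]]) (auto simp: cube_def)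
    then have "(\<Inter>i\<in>{1..k}. A (map Suc (inst k L [i - 1]))) \<in> sets \<mu>"
      using \<open>k \<ge> 1\<close> A_sets by (intro sets.finite_INT) auto
    moreover have "?E = (\<Inter>i\<in>{1..k}. A (map Suc (inst k L [i - 1])))"
      using \<open>k \<ge> 1\<close> by (auto simp: A_def)
    ultimately have E: "?E \<in> sets \<mu>" by simp
    have "\<not> 0 < prob ?E" using null[OF comb_line_inst[OF L n(2) \<open>k \<ge> 1\<close>]] .
    then have "prob ?E = 0" using measure_nonneg[of \<mu> ?E] by linarith
    then have "?E \<in> null_sets \<mu>" using E by (simp add: null_sets_def emeasure_eq_measure)
    from AE_not_in[OF this] show ?thesis by (rule AE_mp) auto
  qed
  \<comment> \<open>Only finitely many words code lines of length \<open>n\<close>, so almost every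
    \<open>x\<close> avoids all of them at once.\<close>
  then have "AE x in \<mu>. \<forall>L\<in>{L \<in> cube (k + 1) n. pspace k 1 n L}. \<not> (\<forall>i\<in>{1..k}. x (map Suc (inst k L [i - 1])))"
    by (intro AE_finite_allI) auto
  then have "AE x in \<mu>. f x \<le> \<delta> / 2"
  proof (rule AE_mp, intro AE_I2 impI)
    fix x assume x: "x \<in> space \<mu>"
      and lines: "\<forall>L\<in>{L \<in> cube (k + 1) n. pspace k 1 n L}. \<not> (\<forall>i\<in>{1..k}. x (map Suc (inst k L [i - 1])))"
    have "\<not> has_space k 1 n (\<lambda>w. x (map Suc w))"
    proof
      assume "has_space k 1 n (\<lambda>w. x (map Suc w))"
      then obtain L where L: "pspace k 1 n L" "\<And>y. y \<in> cube k 1 \<Longrightarrow> x (map Suc (inst k L y))"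
        by (auto simp: has_space_def)
      have "[i - 1] \<in> cube k 1" if "i \<in> {1..k}" for i using that by (auto simp: cube_def)
      then show False using lines L pspace_cube[OF L(1)] by blast
    qed
    then have "dens k n (\<lambda>w. x (map Suc w)) < \<delta> / 2" using N[OF n(1)] by force
    moreover have "f x = dens k n (\<lambda>w. x (map Suc w))"
      unfolding f_def dens_def using x by (simp add: A_def indicator_def)
    ultimately show "f x \<le> \<delta> / 2" by simp
  qed
  then have "expectation f \<le> \<delta> / 2" using int_f by (intro integral_le_const)
  then show False using ge \<open>\<delta> > 0\<close> by simp
qed

end
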